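(* Let $G$ be a finite group. If $1<\eta(G)<2$, then $$\eta(G)\in\left\{\frac54,\ \frac32,\ \frac74,\ \frac{15}{8}\right\}.$$ All four values occur, i.e. each of them equals $\eta(G)$ for some finite group $G$.
   Context: For a finite group $G$, $\mathrm{cyc}(G)$ denotes the number of cyclic subgroups of $G$ (including the trivial one), $\pi(G)$ denotes the number of distinct prime divisors of $|G|$ (so $\pi(1)=0$), and $\eta(G)=\mathrm{cyc}(G)/2^{\pi(G)}$. *)

theory Defs
  imports Complex_Main "HOL-Algebra.Elementary_Groups" "HOL-Computational_Algebra.Primes"
begin

definition cyclic_subgroups :: "('a, 'b) monoid_scheme \<Rightarrow> 'a set set" where
  "cyclic_subgroups G = {H. subgroup H G \<and> cyclic_group (G\<lparr>carrier := H\<rparr>)}"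

definition cyc :: "('a, 'b) monoid_scheme \<Rightarrow> nat" where
  "cyc G = card (cyclic_subgroups G)"

definition num_prime_divisors :: "('a, 'b) monoid_scheme \<Rightarrow> nat" where
  "num_prime_divisors G = card (prime_factors (order G))"

definition eta :: "('a, 'b) monoid_scheme \<Rightarrow> real" where
  "eta G = real (cyc G) / 2 ^ num_prime_divisors G"

end

(* For a finite set s of primes, count only the cyclic subgroups of H whose order involves no primes
   outside s, and divide by 2 to the number of primes of s dividing the order of H; call this e(s, H).
   Let p be smaller than all primes of s. A cyclic subgroup splits uniquely as U V with U a p-group and
   V in the centralizer of U of order involving only primes of s, so for p dividing the order of H
     2 e(s + p, H) = e(s, H) + sum of w(U) over the H-classes of nontrivial cyclic p-subgroups U,
   where w(U) = m / 2^k * e(s, C_H(U)), m is the size of the class of U, and k is the number of primes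
   of s that divide the order of H but not that of C_H(U). No prime q > p divides the order of Aut(U),
   so each of these k primes divides the index m of the normalizer. Hence w(U) >= 1, with
   w(U) = e(s, H) for normal U and w(U) >= 3/2 otherwise. So e(s + p, H) < 2 leaves room for at most two
   classes, and induction from the largest prime down gives e = 1, e = 3/2 or e >= 2 for odd primes,
   and the listed values once p = 2 is added. The one delicate case is p = 2 with three involutions in
   one class and 3 the only missing prime: the involutions generate S_3, or a normal Klein group. *)

theory Submission
  imports Defs "HOL-Algebra.Sylow" "HOL-Algebra.Weak_Morphisms" "HOL-Number_Theory.Residues" "HOL-Library.Countable"
begin

section \<open>Conjugation in a finite group\<close>

text \<open>A group need not have a subgroup whose order is its s-part, so e(s, H) is a count inside
  H and not the invariant of a smaller group. The recursion then meets only subgroups of one fixed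
  group, and the inductions are stated for all of them because centralizers enter. The smallest
  prime is split off because a cyclic group of order p^a, a > 0, has p^(a-1) (p - 1) automorphisms:
  their number has no prime factor above p, while smaller primes can act nontrivially.

  Write e and e' for e(s, .) at H and at the centralizer of an involution, and E for the value at H
  after adding 2. A single class of three or five subgroups with one missing prime gives 2 E = e +
  3/2 e' or 2 E = e + 5/2 e'. So e = e' = 1 yields 5/4 and 7/4, and e = e' = 3/2 with three
  conjugates yields 15/8. The recursion alone would also admit e = 1, e' = 3/2 with three
  conjugates, that is E = 13/8; the delicate case exists to exclude this by tying e to e'.\<close>

locale finite_group = group G for G (structure) +
  assumes finite_carrier: "finite (carrier G)"

definition (in group) conj_by :: "'a \<Rightarrow> 'a \<Rightarrow> 'a" where
  "conj_by h x = h \<otimes> x \<otimes> inv h"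

text \<open>The acting subgroup \<open>H\<close> is a separate argument and need not contain
  \<open>U\<close>: later a cyclic group and a Klein four-group act in this way on subgroups outside
  them.\<close>

definition (in group) conj_class :: "'a set \<Rightarrow> 'a set \<Rightarrow> 'a set set" where
  "conj_class H U = (\<lambda>h. conj_by h ` U) ` H"

definition (in group) normalizer_in :: "'a set \<Rightarrow> 'a set \<Rightarrow> 'a set" where
  "normalizer_in H U = {h \<in> H. conj_by h ` U = U}"

definition (in group) centralizer_in :: "'a set \<Rightarrow> 'a set \<Rightarrow> 'a set" where
  "centralizer_in H U = {h \<in> H. \<forall>u\<in>U. conj_by h u = u}"

context group
begin

lemma conj_by_closed [simp]: "h \<in> carrier G \<Longrightarrow> x \<in> carrier G \<Longrightarrow> conj_by h x \<in> carrier G"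
  by (simp add: conj_by_def)

lemma conj_by_one [simp]: "x \<in> carrier G \<Longrightarrow> conj_by \<one> x = x"
  by (simp add: conj_by_def)

lemma conj_by_mult:
  "g \<in> carrier G \<Longrightarrow> h \<in> carrier G \<Longrightarrow> x \<in> carrier G \<Longrightarrow> conj_by (g \<otimes> h) x = conj_by g (conj_by h x)"
  by (simp add: conj_by_def inv_mult_group m_assoc)

lemma conj_by_inv_cancel [simp]:
  assumes "h \<in> carrier G" "x \<in> carrier G"
  shows "conj_by (inv h) (conj_by h x) = x" "conj_by h (conj_by (inv h) x) = x"
  using conj_by_mult[of "inv h" h x] conj_by_mult[of h "inv h" x] assms by auto

lemma conj_by_hom: "h \<in> carrier G \<Longrightarrow> group_hom G G (conj_by h)"
  by (unfold_locales, auto simp: hom_def conj_by_def m_assoc inv_solve_left)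

lemma conj_by_distrib:
  "h \<in> carrier G \<Longrightarrow> x \<in> carrier G \<Longrightarrow> y \<in> carrier G \<Longrightarrow> conj_by h (x \<otimes> y) = conj_by h x \<otimes> conj_by h y"
  using conj_by_hom[of h] by (auto simp: group_hom_def group_hom_axioms_def hom_def)

lemma conj_by_pow:
  "h \<in> carrier G \<Longrightarrow> x \<in> carrier G \<Longrightarrow> conj_by h (x [^] (n::nat)) = conj_by h x [^] n"
  using group_hom.hom_nat_pow[OF conj_by_hom, of h x n] by simp

lemma inj_on_conj_by: "h \<in> carrier G \<Longrightarrow> inj_on (conj_by h) (carrier G)"
  by (metis conj_by_inv_cancel(1) inj_onI)

lemma conj_by_eq_iff:
  "h \<in> carrier G \<Longrightarrow> x \<in> carrier G \<Longrightarrow> y \<in> carrier G \<Longrightarrow> conj_by h x = y \<longleftrightarrow> h \<otimes> x = y \<otimes> h"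
  by (metis conj_by_def inv_solve_right m_closed)

lemma conj_by_image_mult:
  assumes "g \<in> carrier G" "h \<in> carrier G" "U \<subseteq> carrier G"
  shows "conj_by g ` conj_by h ` U = conj_by (g \<otimes> h) ` U"
proof -
  have "conj_by g (conj_by h u) = conj_by (g \<otimes> h) u" if "u \<in> U" for u
    using conj_by_mult[of g h u] assms that by auto
  then show ?thesis by (simp add: image_image)
qed

lemma conj_by_image_one: "U \<subseteq> carrier G \<Longrightarrow> conj_by \<one> ` U = U"
  by (force simp: image_iff)

lemma conj_by_image_closed: "h \<in> carrier G \<Longrightarrow> U \<subseteq> carrier G \<Longrightarrow> conj_by h ` U \<subseteq> carrier G"
  by auto

lemma conj_by_image_subset:
  assumes "subgroup H G" "h \<in> H" "U \<subseteq> H" shows "conj_by h ` U \<subseteq> H"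
proof
  fix x assume "x \<in> conj_by h ` U"
  then obtain u where u: "u \<in> U" "x = conj_by h u" by auto
  then show "x \<in> H" unfolding u conj_by_def using assms
    by (meson subgroup.m_closed subgroup.m_inv_closed subsetD)
qed

lemma conj_by_inv_image:
  "h \<in> carrier G \<Longrightarrow> U \<subseteq> carrier G \<Longrightarrow> conj_by (inv h) ` conj_by h ` U = U"
  "h \<in> carrier G \<Longrightarrow> U \<subseteq> carrier G \<Longrightarrow> conj_by h ` conj_by (inv h) ` U = U"
  using conj_by_image_mult[of "inv h" h U] conj_by_image_mult[of h "inv h" U] conj_by_image_one[of U]
  by simp_all

lemma normalizer_in_subgroup:
  assumes H: "subgroup H G" and U: "U \<subseteq> carrier G" shows "subgroup (normalizer_in H U) G"
proof
  note HG = subgroup.subset[OF H]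
  show "normalizer_in H U \<subseteq> carrier G" using HG by (auto simp: normalizer_in_def)
  show "\<one> \<in> normalizer_in H U" using U by (simp add: normalizer_in_def subgroup.one_closed[OF H] conj_by_image_one)
  show "x \<otimes> y \<in> normalizer_in H U" if "x \<in> normalizer_in H U" "y \<in> normalizer_in H U" for x y
    using that conj_by_image_mult[of x y U] HG U subgroup.m_closed[OF H, of x y] by (auto simp: normalizer_in_def)
  show "inv x \<in> normalizer_in H U" if "x \<in> normalizer_in H U" for x
    using that conj_by_inv_image(1)[of x U] HG U subgroup.m_inv_closed[OF H, of x]
    by (auto simp: normalizer_in_def)
qed

lemma centralizer_in_subgroup:
  assumes H: "subgroup H G" and U: "U \<subseteq> carrier G" shows "subgroup (centralizer_in H U) G"
proof
  note HG = subgroup.subset[OF H]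
  show "centralizer_in H U \<subseteq> carrier G" using HG by (auto simp: centralizer_in_def)
  show "\<one> \<in> centralizer_in H U" using U by (auto simp: centralizer_in_def subgroup.one_closed[OF H] subset_iff)
  show "x \<otimes> y \<in> centralizer_in H U" if "x \<in> centralizer_in H U" "y \<in> centralizer_in H U" for x y
    using that HG U subgroup.m_closed[OF H, of x y] by (auto simp: centralizer_in_def conj_by_mult subset_iff)
  show "inv x \<in> centralizer_in H U" if "x \<in> centralizer_in H U" for x
  proof -
    have "x \<in> carrier G" using that HG by (auto simp: centralizer_in_def)
    have "conj_by (inv x) u = u" if u: "u \<in> U" for u
    proof -
      have "conj_by x u = u" "u \<in> carrier G" using \<open>x \<in> centralizer_in H U\<close> u U by (auto simp: centralizer_in_def)
      then show ?thesis using conj_by_inv_cancel(1)[OF \<open>x \<in> carrier G\<close>, of u] by simp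
    qed
    then show ?thesis using that subgroup.m_inv_closed[OF H, of x] by (auto simp: centralizer_in_def)
  qed
qed

lemma centralizer_in_subset: "centralizer_in H U \<subseteq> H" by (auto simp: centralizer_in_def)
lemma normalizer_in_subset: "normalizer_in H U \<subseteq> H" by (auto simp: normalizer_in_def)

lemma conj_class_refl: "subgroup H G \<Longrightarrow> U \<subseteq> carrier G \<Longrightarrow> U \<in> conj_class H U"
  unfolding conj_class_def using conj_by_image_one subgroup.one_closed by (metis image_eqI)

lemma conj_class_eq:
  assumes H: "subgroup H G" and U: "U \<subseteq> carrier G" and V: "V \<in> conj_class H U"
  shows "conj_class H V = conj_class H U"
proof -
  note HG = subgroup.subset[OF H]
  obtain h where h: "h \<in> H" "V = conj_by h ` U" using V by (auto simp: conj_class_def)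
  have "conj_by k ` V = conj_by (k \<otimes> h) ` U" if "k \<in> H" for k
    using conj_by_image_mult[of k h U] h HG U that by auto
  then have "conj_class H V = (\<lambda>k. conj_by (k \<otimes> h) ` U) ` H" unfolding conj_class_def by (rule image_cong[OF refl])
  also have "\<dots> = (\<lambda>k. conj_by k ` U) ` ((\<lambda>k. k \<otimes> h) ` H)" by (simp add: image_image)
  also have "(\<lambda>k. k \<otimes> h) ` H = H"
  proof
    show "(\<lambda>k. k \<otimes> h) ` H \<subseteq> H" using h subgroup.m_closed[OF H] by auto
    show "H \<subseteq> (\<lambda>k. k \<otimes> h) ` H"
    proof
      fix x assume "x \<in> H"
      then have "x = (x \<otimes> inv h) \<otimes> h" "x \<otimes> inv h \<in> H"
        using h HG subgroup.m_closed[OF H] subgroup.m_inv_closed[OF H] by (auto simp: m_assoc subset_iff)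
      then show "x \<in> (\<lambda>k. k \<otimes> h) ` H" by blast
    qed
  qed
  finally show ?thesis by (simp add: conj_class_def)
qed

lemma conj_class_disjoint:
  assumes "subgroup H G" "U \<subseteq> carrier G" "V \<subseteq> carrier G" "V \<notin> conj_class H U"
  shows "conj_class H U \<inter> conj_class H V = {}"
  using assms conj_class_eq conj_class_refl by (metis disjoint_iff)

end

section \<open>Orbit counting, Lagrange and Cauchy relative to a subgroup\<close>

context finite_group
begin

lemma finite_subgroup: "subgroup H G \<Longrightarrow> finite H"
  using finite_carrier finite_subset subgroup.subset by blast

lemma card_subgroup_pos: "subgroup H G \<Longrightarrow> card H > 0"
  using finite_subgroup subgroup.one_closed card_gt_0_iff by blast

text \<open>The fibres of the map from h to the conjugate of \<open>U\<close> by h are the left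
  cosets of the normalizer.\<close>

lemma orbit_stabilizer:
  assumes H: "subgroup H G" and U: "U \<subseteq> carrier G"
  shows "card H = card (conj_class H U) * card (normalizer_in H U)"
proof -
  note HG = subgroup.subset[OF H]
  have fin: "finite H" using finite_subgroup[OF H] .
  have fibre: "card {h \<in> H. conj_by h ` U = V} = card (normalizer_in H U)" if V: "V \<in> conj_class H U" for V
  proof -
    obtain k where k: "k \<in> H" "V = conj_by k ` U" using V by (auto simp: conj_class_def)
    have "{h \<in> H. conj_by h ` U = V} = (\<lambda>n. k \<otimes> n) ` normalizer_in H U"
    proof (intro subset_antisym subsetI)
      fix h assume "h \<in> {h \<in> H. conj_by h ` U = V}"
      then have h: "h \<in> H" "conj_by h ` U = V" by auto
      have "conj_by (inv k \<otimes> h) ` U = conj_by (inv k) ` V"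
        using conj_by_image_mult[of "inv k" h U] h k HG U by auto
      also have "\<dots> = U" using conj_by_inv_image(1)[of k U] k HG U by auto
      finally have "inv k \<otimes> h \<in> normalizer_in H U"
        using h k subgroup.m_closed[OF H] subgroup.m_inv_closed[OF H] by (auto simp: normalizer_in_def)
      moreover have "h = k \<otimes> (inv k \<otimes> h)" using h k HG by (auto simp: m_assoc[symmetric] subset_iff)
      ultimately show "h \<in> (\<lambda>n. k \<otimes> n) ` normalizer_in H U" by blast
    next
      fix h assume "h \<in> (\<lambda>n. k \<otimes> n) ` normalizer_in H U"
      then obtain n where "n \<in> H" "conj_by n ` U = U" "h = k \<otimes> n" by (auto simp: normalizer_in_def)
      then show "h \<in> {h \<in> H. conj_by h ` U = V}"
        using conj_by_image_mult[of k n U] k HG U subgroup.m_closed[OF H] by auto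
    qed
    moreover have "inj_on (\<lambda>n. k \<otimes> n) (normalizer_in H U)"
      using k HG normalizer_in_subset[of H U] Units_l_cancel[of k] by (auto intro!: inj_onI simp: subset_iff)
    ultimately show ?thesis by (simp add: card_image)
  qed
  have "card H = card (\<Union>V\<in>conj_class H U. {h \<in> H. conj_by h ` U = V})"
    by (rule arg_cong[where f=card]) (auto simp: conj_class_def)
  also have "\<dots> = (\<Sum>V\<in>conj_class H U. card {h \<in> H. conj_by h ` U = V})"
    using fin by (intro card_UN_disjoint) (auto simp: conj_class_def)
  also have "\<dots> = card (conj_class H U) * card (normalizer_in H U)" using fibre by simp
  finally show ?thesis .
qed

lemma card_conj_class_eq_1:
  assumes H: "subgroup H G" and U: "U \<subseteq> carrier G"
  shows "card (conj_class H U) = 1 \<longleftrightarrow> normalizer_in H U = H"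
proof -
  have "card (conj_class H U) = 1" if "normalizer_in H U = H"
    using orbit_stabilizer[OF H U] that card_subgroup_pos[OF H] by simp
  moreover have "normalizer_in H U = H" if "card (conj_class H U) = 1"
    using orbit_stabilizer[OF H U] that card_subset_eq[OF finite_subgroup[OF H] normalizer_in_subset] by simp
  ultimately show ?thesis by blast
qed

lemma conj_class_of_normalizer_in: "subgroup H G \<Longrightarrow> U \<subseteq> carrier G \<Longrightarrow> normalizer_in H U = H \<Longrightarrow> conj_class H U = {U}"
  unfolding conj_class_def normalizer_in_def using subgroup.one_closed by fastforce

lemma lagrange_subset:
  assumes "subgroup K G" "subgroup H G" "K \<subseteq> H" shows "card K dvd card H"
proof -
  have "subgroup K (G\<lparr>carrier := H\<rparr>)" using assms subgroup_incl by blast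
  from group.lagrange[OF subgroup_imp_group[OF assms(2)] this]
  have "card (rcosets\<^bsub>G\<lparr>carrier := H\<rparr>\<^esub> K) * card K = card H" by (simp add: order_def)
  then show ?thesis by (metis dvd_triv_right)
qed

lemma ord_dvd_card: "subgroup H G \<Longrightarrow> x \<in> H \<Longrightarrow> ord x dvd card H"
  by (metis generate_pow_card lagrange_subset generate_is_subgroup generate_subgroup_incl
      subgroup.mem_carrier empty_subsetI insert_subset)

lemma cauchy:
  assumes H: "subgroup H G" and p: "prime p" "p dvd card H"
  shows "\<exists>x\<in>H. ord x = p"
proof -
  interpret H: group "G\<lparr>carrier := H\<rparr>" using subgroup_imp_group[OF H] .
  \<comment> \<open>Sylow's existence theorem is used with exponent 1, so p may still divide m and
    the subgroup obtained has order exactly p.\<close>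
  obtain m where "card H = p ^ 1 * m" using p by auto
  then obtain K where K: "subgroup K (G\<lparr>carrier := H\<rparr>)" "card K = p"
    using sylow_thm[OF p(1) H.is_group, of 1 m] finite_subgroup[OF H] by (auto simp: order_def)
  have KG: "subgroup K G" "K \<subseteq> H"
    using incl_subgroup[OF H K(1)] subgroup.subset[OF K(1)] by auto
  have "K \<noteq> {\<one>}" using K(2) p(1) by auto
  then obtain x where x: "x \<in> K" "x \<noteq> \<one>" using subgroup.one_closed[OF KG(1)] by auto
  have "x \<in> carrier G" using x KG subgroup.mem_carrier by metis
  then have "ord x = p" using ord_dvd_card[OF KG(1) x(1)] K(2) p(1) ord_eq_1 x(2) prime_nat_iff by auto
  then show ?thesis using x KG by blast
qed

end

section \<open>Cyclic subgroups of restricted order\<close>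

text \<open>The condition sits on a generator, whose order is the order of the subgroup. The trivial
  subgroup always qualifies, even for empty \<open>\<sigma>\<close>, since 1 has no prime
  factors.\<close>

definition (in group) cyclics :: "nat set \<Rightarrow> 'a set \<Rightarrow> 'a set set" where
  "cyclics \<sigma> H = {generate G {x} | x. x \<in> H \<and> prime_factors (ord x) \<subseteq> \<sigma>}"

context group
begin

lemma generate_self: "x \<in> generate G {x}"
  by (simp add: generate.incl)

lemma generate_single_subset: "subgroup H G \<Longrightarrow> x \<in> H \<Longrightarrow> generate G {x} \<subseteq> H"
  by (simp add: generate_subgroup_incl)

lemma generate_single_subgroup: "x \<in> carrier G \<Longrightarrow> subgroup (generate G {x}) G"
  by (simp add: generate_is_subgroup)

lemma pow_mem_generate: "x \<in> carrier G \<Longrightarrow> x [^] (k::nat) \<in> generate G {x}"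
  using generate_pow[of x] by (metis (mono_tags, lifting) UNIV_I int_pow_int mem_Collect_eq)

lemma conj_by_generate:
  "h \<in> carrier G \<Longrightarrow> x \<in> carrier G \<Longrightarrow> conj_by h ` generate G {x} = generate G {conj_by h x}"
  using group_hom.generate_img[OF conj_by_hom, of h "{x}"] by simp

lemma ord_conj_by:
  assumes "h \<in> carrier G" "x \<in> carrier G" shows "ord (conj_by h x) = ord x"
proof -
  have "generate G {x} \<subseteq> carrier G" using assms generate_single_subgroup subgroup.subset by blast
  then have "card (conj_by h ` generate G {x}) = card (generate G {x})"
    using inj_on_conj_by[OF assms(1)] by (meson card_image inj_on_subset)
  then show ?thesis using assms by (simp add: conj_by_generate generate_pow_card)
qed

text \<open>Only one inclusion is computed; applying it to the inverse of \<open>h\<close> gives the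
  other.\<close>

lemma centralizer_in_conj_by:
  assumes H: "subgroup H G" and h: "h \<in> H" and U: "U \<subseteq> carrier G"
  shows "centralizer_in H (conj_by h ` U) = conj_by h ` centralizer_in H U"
proof -
  note HG = subgroup.subset[OF H]
  have sub: "conj_by k ` centralizer_in H W \<subseteq> centralizer_in H (conj_by k ` W)" if k: "k \<in> H" and W: "W \<subseteq> carrier G" for k W
  proof
    fix y assume "y \<in> conj_by k ` centralizer_in H W"
    then obtain x where x: "x \<in> H" "\<forall>u\<in>W. conj_by x u = u" "y = conj_by k x" by (auto simp: centralizer_in_def)
    have "y \<in> H" using conj_by_image_subset[OF H k, of "{x}"] x by simp
    moreover have "conj_by y (conj_by k u) = conj_by k u" if "u \<in> W" for u
    proof -
      have c: "x \<in> carrier G" "k \<in> carrier G" "u \<in> carrier G" using x k HG W that by auto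
      have "y \<otimes> k = k \<otimes> x" using c by (simp add: x(3) conj_by_def m_assoc)
      then have "conj_by y (conj_by k u) = conj_by k (conj_by x u)"
        using c x(3) by (simp flip: conj_by_mult)
      then show ?thesis using x(2) that by simp
    qed
    ultimately show "y \<in> centralizer_in H (conj_by k ` W)" by (auto simp: centralizer_in_def)
  qed
  have hc: "h \<in> carrier G" "inv h \<in> H" using h HG subgroup.m_inv_closed[OF H h] by auto
  have "centralizer_in H (conj_by h ` U) = conj_by h ` conj_by (inv h) ` centralizer_in H (conj_by h ` U)"
    using conj_by_inv_image(2)[OF hc(1)] centralizer_in_subset[of H] HG by (metis subset_trans)
  also have "\<dots> \<subseteq> conj_by h ` centralizer_in H (conj_by (inv h) ` conj_by h ` U)"
    using sub[OF hc(2) conj_by_image_closed[OF hc(1) U]] by (rule image_mono)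
  also have "conj_by (inv h) ` conj_by h ` U = U" using conj_by_inv_image(1)[OF hc(1) U] .
  finally show ?thesis using sub[OF h U] by blast
qed

text \<open>Commuting means being fixed under conjugation, which is a homomorphism; this introduces
  the two exponents one after the other.\<close>

lemma pow_commutes:
  assumes "x \<otimes> y = y \<otimes> x" "x \<in> carrier G" "y \<in> carrier G"
  shows "x [^] (m::nat) \<otimes> y [^] (n::nat) = y [^] n \<otimes> x [^] m"
proof -
  have "conj_by x y = y" using assms by (simp add: conj_by_eq_iff)
  then have "conj_by x (y [^] n) = y [^] n" using assms by (simp add: conj_by_pow)
  then have "conj_by (y [^] n) x = x" using assms by (simp add: conj_by_eq_iff)
  then have "conj_by (y [^] n) (x [^] m) = x [^] m" using assms by (simp add: conj_by_pow)
  then show ?thesis using assms by (simp add: conj_by_eq_iff)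
qed

lemma pow_eq_cong:
  assumes "x \<in> carrier G" "[a = b] (mod ord x)" shows "x [^] (a::nat) = x [^] b"
proof -
  have "[int b = int a] (mod int (ord x))" using assms(2) by (simp add: cong_int_iff cong_sym)
  then have "int (ord x) dvd int b - int a" by (simp add: cong_iff_dvd_diff)
  then have "x [^] int a = x [^] int b" using int_pow_eq[OF assms(1)] by blast
  then show ?thesis by (simp add: int_pow_int)
qed

lemma ord_mult_coprime:
  assumes c: "x \<otimes> y = y \<otimes> x" and xy: "x \<in> carrier G" "y \<in> carrier G" and cop: "coprime (ord x) (ord y)"
  shows "ord (x \<otimes> y) = ord x * ord y"
proof -
  have "(x \<otimes> y) [^] n = \<one> \<longleftrightarrow> ord x * ord y dvd n" for n :: nat
  proof
    assume "ord x * ord y dvd n"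
    then have "ord x dvd n" "ord y dvd n" using dvd_mult_left dvd_mult_right by blast+
    then have "x [^] n = \<one>" "y [^] n = \<one>" using xy by (simp_all add: pow_eq_id)
    then show "(x \<otimes> y) [^] n = \<one>" using pow_mult_distrib[OF c xy] by simp
  next
    assume "(x \<otimes> y) [^] n = \<one>"
    then have e: "x [^] n \<otimes> y [^] n = \<one>" using pow_mult_distrib[OF c xy, of n] by simp
    \<comment> \<open>The power \<open>ord y\<close> removes y from the relation and leaves a
      condition on x alone, from which coprimality cancels \<open>ord y\<close>.\<close>
    have "x [^] (n * ord y) \<otimes> y [^] (n * ord y) = (x [^] n \<otimes> y [^] n) [^] ord y"
      using xy pow_mult_distrib[OF pow_commutes[OF c xy, of n n]] by (simp add: nat_pow_pow)
    moreover have "y [^] (n * ord y) = \<one>" using xy by (simp add: pow_eq_id)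
    ultimately have "x [^] (n * ord y) = \<one>" using e xy by simp
    then have "ord x dvd n" using xy cop by (simp add: pow_eq_id coprime_dvd_mult_left_iff)
    then have "x [^] n = \<one>" using xy by (simp add: pow_eq_id)
    then have "y [^] n = \<one>" using e xy by simp
    then have "ord y dvd n" using xy by (simp add: pow_eq_id)
    with \<open>ord x dvd n\<close> cop show "ord x * ord y dvd n" by (simp add: divides_mult)
  qed
  then show ?thesis using ord_unique[of "x \<otimes> y"] xy by simp
qed

end

section \<open>Splitting a cyclic subgroup into its p-part and the remaining part\<close>

context finite_group
begin

lemma prime_factors_empty_nat: "prime_factors n = {} \<Longrightarrow> n > 0 \<Longrightarrow> n = (1::nat)"
  by (metis in_prime_factors_iff empty_iff less_irrefl prime_factor_nat)

lemma ord_pos: "x \<in> carrier G \<Longrightarrow> ord x > 0"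
  using ord_ge_1[OF finite_carrier] by (metis gr0I not_one_le_zero)

lemma generate_powers: "x \<in> carrier G \<Longrightarrow> generate G {x} = {x [^] k |k::nat. True}"
  using generate_pow_on_finite_carrier[OF finite_carrier] by simp

lemma cyclicsE:
  assumes "U \<in> cyclics \<sigma> H"
  obtains x where "x \<in> H" "U = generate G {x}" "prime_factors (ord x) \<subseteq> \<sigma>"
  using assms by (auto simp: cyclics_def)

lemma cyclicsI: "x \<in> H \<Longrightarrow> prime_factors (ord x) \<subseteq> \<sigma> \<Longrightarrow> generate G {x} \<in> cyclics \<sigma> H"
  by (auto simp: cyclics_def)

lemma cyclics_subset: "subgroup H G \<Longrightarrow> U \<in> cyclics \<sigma> H \<Longrightarrow> U \<subseteq> H"
  by (auto elim!: cyclicsE dest: generate_single_subset)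

lemma cyclics_carrier: "subgroup H G \<Longrightarrow> U \<in> cyclics \<sigma> H \<Longrightarrow> U \<subseteq> carrier G"
  using cyclics_subset subgroup.subset by blast

lemma cyclics_subgroup: "subgroup H G \<Longrightarrow> U \<in> cyclics \<sigma> H \<Longrightarrow> subgroup U G"
  by (metis cyclicsE generate_single_subgroup subgroup.mem_carrier)

lemma finite_cyclics: "subgroup H G \<Longrightarrow> finite (cyclics \<sigma> H)"
  by (rule finite_subset[of _ "Pow H"]) (auto dest: cyclics_subset simp: finite_subgroup)

lemma generate_one: "generate G {\<one>} = {\<one>}"
  using generate_powers[OF one_closed] by auto

lemma one_in_cyclics: "subgroup H G \<Longrightarrow> {\<one>} \<in> cyclics \<sigma> H"
  using cyclicsI[of \<one> H \<sigma>] by (simp add: generate_one subgroup.one_closed)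

lemma cyclics_empty: "subgroup H G \<Longrightarrow> cyclics {} H = {{\<one>}}"
proof -
  assume H: "subgroup H G"
  have "x = \<one>" if x: "x \<in> H" "prime_factors (ord x) \<subseteq> {}" for x
  proof -
    have "x \<in> carrier G" using subgroup.mem_carrier[OF H x(1)] .
    moreover have "ord x = 1"
      using x(2) ord_pos[OF \<open>x \<in> carrier G\<close>] prime_factors_empty_nat[of "ord x"] by blast
    ultimately show ?thesis using ord_eq_1 by blast
  qed
  then have "cyclics {} H \<subseteq> {{\<one>}}" unfolding cyclics_def using generate_one by fastforce
  then show ?thesis using one_in_cyclics[OF H, of "{}"] by blast
qed

lemma cyclics_conj_by:
  assumes h: "h \<in> carrier G" and K: "K \<subseteq> carrier G"
  shows "cyclics \<sigma> (conj_by h ` K) = (\<lambda>U. conj_by h ` U) ` cyclics \<sigma> K"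
proof -
  let ?X = "{x \<in> K. prime_factors (ord x) \<subseteq> \<sigma>}"
  have "cyclics \<sigma> (conj_by h ` K) = (\<lambda>x. generate G {conj_by h x}) ` ?X"
    using K by (auto simp: cyclics_def ord_conj_by[OF h] subset_iff)
  also have "\<dots> = (\<lambda>x. conj_by h ` generate G {x}) ` ?X"
    using K conj_by_generate[OF h] by (intro image_cong refl) (auto simp: subset_iff)
  also have "\<dots> = (\<lambda>U. conj_by h ` U) ` cyclics \<sigma> K"
    by (auto simp: cyclics_def)
  finally show ?thesis .
qed

lemma card_conj_by: "h \<in> carrier G \<Longrightarrow> U \<subseteq> carrier G \<Longrightarrow> card (conj_by h ` U) = card U"
  by (meson card_image inj_on_conj_by inj_on_subset)

lemma card_cyclics_conj_by:
  assumes "h \<in> carrier G" "subgroup K G"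
  shows "card (cyclics \<sigma> (conj_by h ` K)) = card (cyclics \<sigma> K)"
proof -
  have "inj_on (\<lambda>U. conj_by h ` U) (cyclics \<sigma> K)"
    using cyclics_carrier[OF assms(2)] conj_by_inv_image(1)[OF assms(1)] by (metis inj_onI)
  then show ?thesis
    using cyclics_conj_by[OF assms(1) subgroup.subset[OF assms(2)]] by (simp add: card_image)
qed

lemma generate_mult_coprime:
  assumes c: "u \<otimes> v = v \<otimes> u" and uv: "u \<in> carrier G" "v \<in> carrier G" and cop: "coprime (ord u) (ord v)"
  shows "u \<in> generate G {u \<otimes> v}" "v \<in> generate G {u \<otimes> v}"
    "generate G {u \<otimes> v} = generate G {u} <#> generate G {v}"
proof -
  have aux: "x \<in> generate G {x \<otimes> y}" if c: "x \<otimes> y = y \<otimes> x" "x \<in> carrier G" "y \<in> carrier G" "coprime (ord x) (ord y)" for x y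
  proof -
    \<comment> \<open>The exponent \<open>ord y * k\<close> is 1 modulo \<open>ord x\<close> and 0
      modulo \<open>ord y\<close>, so this power of the product is x.\<close>
    obtain k where k: "[ord y * k = 1] (mod ord x)"
      using cong_solve_coprime_nat[of "ord y" "ord x"] c(4) by (auto simp: coprime_commute)
    have "x [^] (ord y * k) = x" using pow_eq_cong[OF c(2) k] c(2) by simp
    moreover have "y [^] (ord y * k) = \<one>" using c(3) by (simp add: pow_eq_id)
    ultimately have "(x \<otimes> y) [^] (ord y * k) = x"
      using pow_mult_distrib[OF c(1-3), of "ord y * k"] c(2,3) by simp
    then show ?thesis using pow_mem_generate[of "x \<otimes> y" "ord y * k"] c by simp
  qed
  show u: "u \<in> generate G {u \<otimes> v}" using aux[of u v] assms by simp
  show v: "v \<in> generate G {u \<otimes> v}" using aux[of v u] assms by (simp add: coprime_commute)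
  have sg: "subgroup (generate G {u \<otimes> v}) G" using uv generate_single_subgroup by simp
  show "generate G {u \<otimes> v} = generate G {u} <#> generate G {v}"
  proof (intro subset_antisym subsetI)
    fix x assume "x \<in> generate G {u \<otimes> v}"
    then obtain k::nat where "x = (u \<otimes> v) [^] k" using generate_powers[of "u \<otimes> v"] uv by auto
    then have "x = u [^] k \<otimes> v [^] k" using pow_mult_distrib[OF c uv] by simp
    then show "x \<in> generate G {u} <#> generate G {v}"
      using pow_mem_generate uv by (auto simp: set_mult_def)
  next
    fix x assume "x \<in> generate G {u} <#> generate G {v}"
    then obtain a b where "a \<in> generate G {u}" "b \<in> generate G {v}" "x = a \<otimes> b" by (auto simp: set_mult_def)
    then show "x \<in> generate G {u \<otimes> v}"
      using generate_single_subset[OF sg u] generate_single_subset[OF sg v] subgroup.m_closed[OF sg] by blast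
  qed
qed

lemma coprime_of_prime_factors:
  fixes a b :: nat
  assumes "a > 0" "b > 0" "prime_factors a \<subseteq> S" "prime_factors b \<subseteq> T" "S \<inter> T = {}"
  shows "coprime a b"
proof (rule ccontr)
  assume "\<not> coprime a b"
  then obtain q where q: "prime q" "q dvd a" "q dvd b"
    using prime_factor_nat[of "gcd a b"] by (auto simp: coprime_iff_gcd_eq_1)
  then have "q \<in> prime_factors a" "q \<in> prime_factors b" using assms by (auto simp: in_prime_factors_iff)
  then show False using assms by blast
qed

text \<open>Describes the factor generated by u through the product group alone, by the orders of
  its elements. This is the uniqueness half of the splitting.\<close>

lemma part_of_generate_mult:
  assumes c: "u \<otimes> v = v \<otimes> u" and uv: "u \<in> carrier G" "v \<in> carrier G"
    and S: "prime_factors (ord u) \<subseteq> S" and T: "prime_factors (ord v) \<subseteq> T" and ST: "S \<inter> T = {}"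
  shows "{x \<in> generate G {u \<otimes> v}. prime_factors (ord x) \<subseteq> S} = generate G {u}"
proof (intro subset_antisym subsetI)
  have cop: "coprime (ord u) (ord v)" using coprime_of_prime_factors[OF _ _ S T ST] ord_pos uv by simp
  fix x assume "x \<in> {x \<in> generate G {u \<otimes> v}. prime_factors (ord x) \<subseteq> S}"
  then obtain k::nat where k: "x = (u \<otimes> v) [^] k" and x: "prime_factors (ord x) \<subseteq> S"
    using generate_powers[of "u \<otimes> v"] uv by auto
  have xk: "x = u [^] k \<otimes> v [^] k" using k pow_mult_distrib[OF c uv] by simp
  have d: "ord (u [^] k) dvd ord u" "ord (v [^] k) dvd ord v"
    using uv by (simp_all add: nat_pow_pow flip: pow_eq_id) (simp_all add: pow_eq_id)
  \<comment> \<open>Because the order is multiplicative here, the primes of the v-component of x lie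
    both in S and in T, so that component is trivial.\<close>
  have "ord x = ord (u [^] k) * ord (v [^] k)" unfolding xk
    using d cop uv pow_commutes[OF c uv, of k k] by (intro ord_mult_coprime) (auto intro: coprime_divisors)
  then have "prime_factors (ord (v [^] k)) \<subseteq> prime_factors (ord x)"
    using ord_pos uv by (simp add: prime_factors_product)
  moreover have "prime_factors (ord (v [^] k)) \<subseteq> prime_factors (ord v)"
    using dvd_prime_factors[OF _ d(2)] ord_pos[OF uv(2)] by simp
  ultimately have "prime_factors (ord (v [^] k)) = {}" using x T ST by blast
  then have "ord (v [^] k) = 1"
    using ord_pos[of "v [^] k"] uv prime_factors_empty_nat[of "ord (v [^] k)"] by blast
  then have "v [^] k = \<one>" using uv ord_eq_1 by simp
  then show "x \<in> generate G {u}" using xk uv pow_mem_generate by simp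
next
  have cop: "coprime (ord u) (ord v)" using coprime_of_prime_factors[OF _ _ S T ST] ord_pos uv by simp
  fix x assume x: "x \<in> generate G {u}"
  then have "x \<in> generate G {u \<otimes> v}"
    using generate_mult_coprime(1)[OF c uv cop] generate_single_subset[OF generate_single_subgroup, of "u \<otimes> v" u] uv by auto
  moreover have "ord x dvd ord u"
    using ord_dvd_card[OF generate_single_subgroup[OF uv(1)] x] uv by (simp add: generate_pow_card)
  then have "prime_factors (ord x) \<subseteq> S" using S dvd_prime_factors[of "ord u" "ord x"] ord_pos[OF uv(1)] by auto
  ultimately show "x \<in> {x \<in> generate G {u \<otimes> v}. prime_factors (ord x) \<subseteq> S}" by simp
qed

lemma split_element:
  assumes w: "w \<in> carrier G" and p: "prime p" "prime_factors (ord w) \<subseteq> insert p \<sigma>" "p \<notin> \<sigma>"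
  obtains u v where "u \<in> generate G {w}" "v \<in> generate G {w}" "w = u \<otimes> v" "u \<otimes> v = v \<otimes> u"
    "prime_factors (ord u) \<subseteq> {p}" "prime_factors (ord v) \<subseteq> \<sigma>"
proof -
  have n: "ord w \<noteq> 0" using ord_pos[OF w] by simp
  obtain m where m: "ord w = p ^ multiplicity p (ord w) * m" "\<not> p dvd m"
    using multiplicity_decompose'[of "ord w" p] n p(1) by (metis not_prime_unit)
  define q where "q = p ^ multiplicity p (ord w)"
  have cop: "coprime q m" unfolding q_def using m(2) p(1) by (simp add: prime_imp_coprime coprime_power_left_iff)
  \<comment> \<open>\<open>k\<close> and \<open>l\<close> are the Chinese remainder idempotents for
    the p-part q of the order and its cofactor m. Their sum is 1 modulo \<open>ord w\<close>, which
    writes w as the product of its two powers.\<close>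
  obtain k where k: "[k = 1] (mod q)" "[k = 0] (mod m)"
    using binary_chinese_remainder_nat[OF cop, of 1 0] by auto
  obtain l where l: "[l = 0] (mod q)" "[l = 1] (mod m)"
    using binary_chinese_remainder_nat[OF cop, of 0 1] by auto
  have nm: "ord w = q * m" using m(1) q_def by simp
  have "[k + l = 1] (mod q * m)"
    using cong_add[OF k(1) l(1)] cong_add[OF k(2) l(2)] cop by (auto intro!: coprime_cong_mult_nat)
  then have "w [^] (k + l) = w" using pow_eq_cong[OF w, of "k + l" 1] w nm by simp
  then have wkl: "w = w [^] k \<otimes> w [^] l" using w by (simp add: nat_pow_mult)
  have "(w [^] k) [^] q = \<one>" "(w [^] l) [^] m = \<one>"
    using k(2) l(1) w nm by (auto simp: nat_pow_pow pow_eq_id cong_0_iff mult.commute mult_dvd_mono)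
  then have d: "ord (w [^] k) dvd q" "ord (w [^] l) dvd m" using w by (simp_all add: pow_eq_id)
  have q0: "q \<noteq> 0" "m \<noteq> 0" using n nm by auto
  have "prime_factors (ord (w [^] k)) \<subseteq> prime_factors q" using dvd_prime_factors[OF q0(1) d(1)] .
  also have "\<dots> \<subseteq> {p}"
  proof
    fix x assume "x \<in> prime_factors q"
    then have "prime x" "x dvd p" unfolding q_def using prime_dvd_power by (auto simp: in_prime_factors_iff)
    then show "x \<in> {p}" using p(1) primes_dvd_imp_eq by blast
  qed
  finally have 1: "prime_factors (ord (w [^] k)) \<subseteq> {p}" .
  have "prime_factors (ord (w [^] l)) \<subseteq> prime_factors m" using dvd_prime_factors[OF q0(2) d(2)] .
  also have "\<dots> \<subseteq> prime_factors (ord w) - {p}" using m(2) nm n by (auto simp: in_prime_factors_iff)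
  finally have 2: "prime_factors (ord (w [^] l)) \<subseteq> \<sigma>" using p by auto
  show ?thesis
    using that[of "w [^] k" "w [^] l"] 1 2 wkl w pow_mem_generate by (simp add: nat_pow_comm)
qed

lemma generate_centralizer_in:
  assumes "subgroup H G" "u \<in> carrier G" 
  shows "v \<in> centralizer_in H (generate G {u}) \<longleftrightarrow> v \<in> H \<and> v \<otimes> u = u \<otimes> v"
proof
  assume v: "v \<in> centralizer_in H (generate G {u})"
  then have "v \<in> carrier G" using subgroup.mem_carrier[OF assms(1)] centralizer_in_subset by blast
  then show "v \<in> H \<and> v \<otimes> u = u \<otimes> v" using v assms generate_self[of u] by (auto simp: centralizer_in_def conj_by_eq_iff)
next
  assume v: "v \<in> H \<and> v \<otimes> u = u \<otimes> v"
  then have vc: "v \<in> carrier G" using subgroup.mem_carrier[OF assms(1)] by blast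
  have "conj_by v (u [^] k) = u [^] k" for k :: nat
  proof -
    have "conj_by v u = u" using v vc assms by (simp add: conj_by_eq_iff)
    then show ?thesis using vc assms by (simp add: conj_by_pow)
  qed
  then show "v \<in> centralizer_in H (generate G {u})" using v generate_powers[OF assms(2)] by (auto simp: centralizer_in_def)
qed

text \<open>The pair (U, V) goes to the product set of U and V. The inverse map keeps the elements
  of p-power order and those whose order involves only primes of \<open>\<sigma>\<close>;
  surjectivity comes from splitting a generator. Two generators commute exactly when the second lies
  in the centralizer of the group of the first, hence the centralizer in the sum.\<close>

lemma card_cyclics_insert:
  assumes H: "subgroup H G" and p: "prime p" "p \<notin> \<sigma>"
  shows "card (cyclics (insert p \<sigma>) H) = (\<Sum>U\<in>cyclics {p} H. card (cyclics \<sigma> (centralizer_in H U)))"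
proof -
  note HG = subgroup.mem_carrier[OF H]
  let ?S = "Sigma (cyclics {p} H) (\<lambda>U. cyclics \<sigma> (centralizer_in H U))"
  let ?part = "\<lambda>S W. {x \<in> W. prime_factors (ord x) \<subseteq> S}"
  have rep: "\<exists>u v. u \<in> H \<and> v \<in> H \<and> U = generate G {u} \<and> V = generate G {v} \<and> u \<otimes> v = v \<otimes> u
      \<and> prime_factors (ord u) \<subseteq> {p} \<and> prime_factors (ord v) \<subseteq> \<sigma>" if UV: "(U, V) \<in> ?S" for U V
  proof -
    obtain u where u: "u \<in> H" "U = generate G {u}" "prime_factors (ord u) \<subseteq> {p}" using UV by (auto elim!: cyclicsE)
    obtain v where v: "v \<in> centralizer_in H U" "V = generate G {v}" "prime_factors (ord v) \<subseteq> \<sigma>" using UV by (auto elim!: cyclicsE)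
    then show ?thesis using u generate_centralizer_in[OF H HG, of u v] by metis
  qed
  have disj: "{p} \<inter> \<sigma> = {}" "\<sigma> \<inter> {p} = {}" using p by auto
  have "bij_betw (\<lambda>(U, V). U <#> V) ?S (cyclics (insert p \<sigma>) H)"
  proof (rule bij_betw_imageI)
    have "?part {p} (U <#> V) = U \<and> ?part \<sigma> (U <#> V) = V" if UV: "(U, V) \<in> ?S" for U V
    proof -
      obtain u v where uv: "u \<in> H" "v \<in> H" "U = generate G {u}" "V = generate G {v}" "u \<otimes> v = v \<otimes> u"
        "prime_factors (ord u) \<subseteq> {p}" "prime_factors (ord v) \<subseteq> \<sigma>" using rep[OF UV] by blast
      then have cop: "coprime (ord u) (ord v)" using coprime_of_prime_factors[OF _ _ uv(6,7) disj(1)] ord_pos HG by simp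
      show ?thesis
        using generate_mult_coprime(3)[OF uv(5) HG HG cop] uv
          part_of_generate_mult[OF uv(5) HG HG uv(6,7) disj(1)]
          part_of_generate_mult[OF uv(5)[symmetric] HG HG uv(7,6) disj(2)] by simp
    qed
    then show "inj_on (\<lambda>(U, V). U <#> V) ?S"
      by (intro inj_on_inverseI[where g = "\<lambda>W. (?part {p} W, ?part \<sigma> W)"]) (simp add: split_paired_all)
    show "(\<lambda>(U, V). U <#> V) ` ?S = cyclics (insert p \<sigma>) H"
    proof (intro subset_antisym subsetI)
      fix W assume "W \<in> (\<lambda>(U, V). U <#> V) ` ?S"
      then obtain U V where UV: "(U, V) \<in> ?S" "W = U <#> V" by auto
      obtain u v where uv: "u \<in> H" "v \<in> H" "U = generate G {u}" "V = generate G {v}" "u \<otimes> v = v \<otimes> u"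
        "prime_factors (ord u) \<subseteq> {p}" "prime_factors (ord v) \<subseteq> \<sigma>" using rep[OF UV(1)] by blast
      then have cop: "coprime (ord u) (ord v)" using coprime_of_prime_factors[OF _ _ uv(6,7) disj(1)] ord_pos HG by simp
      have "prime_factors (ord (u \<otimes> v)) = prime_factors (ord u) \<union> prime_factors (ord v)"
        using ord_mult_coprime[OF uv(5) HG HG cop] uv ord_pos HG by (simp add: prime_factors_product)
      then show "W \<in> cyclics (insert p \<sigma>) H"
        using cyclicsI[of "u \<otimes> v" H "insert p \<sigma>"] uv subgroup.m_closed[OF H] UV(2)
          generate_mult_coprime(3)[OF uv(5) HG HG cop] by auto
    next
      fix W assume "W \<in> cyclics (insert p \<sigma>) H"
      then obtain w where w: "w \<in> H" "W = generate G {w}" "prime_factors (ord w) \<subseteq> insert p \<sigma>" by (auto elim: cyclicsE)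
      obtain u v where uv: "u \<in> generate G {w}" "v \<in> generate G {w}" "w = u \<otimes> v" "u \<otimes> v = v \<otimes> u"
        "prime_factors (ord u) \<subseteq> {p}" "prime_factors (ord v) \<subseteq> \<sigma>"
        using split_element[OF HG[OF w(1)] p(1) w(3) p(2)] by metis
      have uH: "u \<in> H" "v \<in> H" using uv generate_single_subset[OF H w(1)] by auto
      have cop: "coprime (ord u) (ord v)" using coprime_of_prime_factors[OF _ _ uv(5,6) disj(1)] ord_pos HG uH by simp
      have "generate G {u} \<in> cyclics {p} H" using cyclicsI uH uv by simp
      moreover have "generate G {v} \<in> cyclics \<sigma> (centralizer_in H (generate G {u}))"
        using cyclicsI generate_centralizer_in[OF H HG[OF uH(1)], of v] uH uv by simp
      moreover have "W = generate G {u} <#> generate G {v}"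
        using generate_mult_coprime(3)[OF uv(4) HG HG cop] uH uv(3) w(2) by simp
      ultimately show "W \<in> (\<lambda>(U, V). U <#> V) ` ?S" by (auto intro!: image_eqI[of _ _ "(generate G {u}, generate G {v})"])
    qed
  qed
  then have "card (cyclics (insert p \<sigma>) H) = card ?S" by (simp add: bij_betw_same_card)
  also have "\<dots> = (\<Sum>U\<in>cyclics {p} H. card (cyclics \<sigma> (centralizer_in H U)))"
    using finite_cyclics[OF H] by (intro card_SigmaI) (auto intro!: finite_cyclics centralizer_in_subgroup H cyclics_carrier[OF H])
  finally show ?thesis .
qed

end

section \<open>The recursion over the smallest prime\<close>

lemma prime_factors_subset_singleton:
  fixes n :: nat
  assumes "prime p" "n > 0" "prime_factors n \<subseteq> {p}" shows "\<exists>a. n = p ^ a"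
proof -
  have "n = (\<Prod>q\<in>prime_factors n. q ^ multiplicity q n)"
    using prod_prime_factors[of n] assms(2) by simp
  also have "\<dots> = (\<Prod>q\<in>{p}. q ^ multiplicity q n)"
    using assms by (intro prod.mono_neutral_left) (auto simp: prime_factors_multiplicity)
  finally show ?thesis by auto
qed

lemma prod_primes_dvd:
  fixes m :: nat
  assumes "finite A" "\<And>q. q \<in> A \<Longrightarrow> prime q" "\<And>q. q \<in> A \<Longrightarrow> q dvd m"
  shows "\<Prod>A dvd m"
  using assms
proof (induction A)
  case (insert q A)
  have "coprime q x" if "x \<in> A" for x using insert.prems(1)[of q] insert.prems(1)[of x] insert.hyps that
    by (auto intro!: primes_coprime)
  then have "coprime q (\<Prod>A)" by (rule prod_coprime_right)
  then show ?case using insert by (simp add: divides_mult)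
qed simp

text \<open>Each prime of M costs a factor 2 in the denominator but contributes a factor of at least
  b to m, since distinct primes multiply.\<close>

lemma primes_prod_ratio_ge:
  assumes "finite M" "\<And>q. q \<in> M \<Longrightarrow> prime (q::nat)" "\<And>q. q \<in> M \<Longrightarrow> q dvd m" "m > 0" "\<And>q. q \<in> M \<Longrightarrow> b \<le> q"
  shows "(real b / 2) ^ card M \<le> real m / 2 ^ card M"
proof -
  have "\<Prod>M dvd m" using prod_primes_dvd[of M m] assms by blast
  then have "\<Prod>M \<le> m" using assms(4) dvd_imp_le by blast
  moreover have "b ^ card M \<le> \<Prod>M" using prod_mono[of M "\<lambda>_. b" "\<lambda>q. q"] assms(5) by simp
  ultimately have "real (b ^ card M) \<le> real m" by linarith
  then show ?thesis by (simp add: power_divide divide_right_mono)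
qed

section \<open>Normalized counts and the weight of a conjugacy class\<close>

definition (in group) num_primes :: "nat set \<Rightarrow> 'a set \<Rightarrow> nat" where
  "num_primes \<sigma> H = card {q \<in> \<sigma>. q dvd card H}"

text \<open>The e(s, H) of the overview. With all primes of the group order and the whole carrier it
  becomes \<open>eta\<close>.\<close>

definition (in group) eta_part :: "nat set \<Rightarrow> 'a set \<Rightarrow> real" where
  "eta_part \<sigma> H = real (card (cyclics \<sigma> H)) / 2 ^ num_primes \<sigma> H"

definition (in group) missing :: "nat set \<Rightarrow> 'a set \<Rightarrow> 'a set \<Rightarrow> nat set" where
  "missing \<sigma> H U = {q \<in> \<sigma>. q dvd card H \<and> \<not> q dvd card (centralizer_in H U)}"

text \<open>The contribution of one subgroup. The denominator belongs to \<open>H\<close> and not to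
  the centralizer, so that shares of different subgroups can be added; over a class they sum to
  \<open>weight\<close>, where the discrepancy of the denominators has become the power of 2 for the
  missing primes.\<close>

definition (in group) share :: "nat set \<Rightarrow> 'a set \<Rightarrow> 'a set \<Rightarrow> real" where
  "share \<sigma> H U = real (card (cyclics \<sigma> (centralizer_in H U))) / 2 ^ num_primes \<sigma> H"

definition (in group) weight :: "nat set \<Rightarrow> 'a set \<Rightarrow> 'a set \<Rightarrow> real" where
  "weight \<sigma> H U = real (card (conj_class H U)) / 2 ^ card (missing \<sigma> H U) * eta_part \<sigma> (centralizer_in H U)"

definition primes_above :: "nat \<Rightarrow> nat set \<Rightarrow> bool" where
  "primes_above p \<sigma> \<longleftrightarrow> finite \<sigma> \<and> (\<forall>q\<in>\<sigma>. prime q \<and> p < q)"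

context finite_group
begin

lemma conj_by_pow_left:
  assumes x: "x \<in> carrier G" and u: "u \<in> carrier G" and j: "conj_by x u = u [^] (j::nat)"
  shows "conj_by (x [^] (i::nat)) u = u [^] (j ^ i)"
proof (induction i)
  case 0 then show ?case using u by simp
next
  case (Suc i)
  have "conj_by (x [^] Suc i) u = conj_by (x [^] i) (conj_by x u)" using x u by (simp add: conj_by_mult)
  also have "\<dots> = (conj_by (x [^] i) u) [^] j" using x u by (simp add: j conj_by_pow)
  also have "\<dots> = u [^] (j ^ Suc i)" using u by (simp add: Suc nat_pow_pow mult.commute)
  finally show ?case .
qed

text \<open>With u a generator of U, of order p^a, conjugation by x sends u to a power u^j with j
  coprime to p^a. By Euler's theorem the power of x with exponent \<open>totient (p ^ a)\<close>
  centralizes U. The primes of this totient are at most p, so it is coprime to \<open>ord x\<close>,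
  and x is a power of that centralizing element.\<close>

lemma normalizer_in_imp_centralizer_in:
  assumes H: "subgroup H G" and p: "prime p" and U: "U \<in> cyclics {p} H"
    and x: "x \<in> normalizer_in H U" "\<forall>q\<in>prime_factors (ord x). p < q"
  shows "x \<in> centralizer_in H U"
proof -
  obtain u where u: "u \<in> H" "U = generate G {u}" "prime_factors (ord u) \<subseteq> {p}" using U by (auto elim: cyclicsE)
  have uc: "u \<in> carrier G" and xH: "x \<in> H" and xc: "x \<in> carrier G"
    using u x normalizer_in_subset subgroup.mem_carrier[OF H] by blast+
  obtain a where a: "ord u = p ^ a" using prime_factors_subset_singleton[OF p ord_pos[OF uc] u(3)] by blast
  let ?t = "totient (ord u)"
  have cop: "coprime ?t (ord x)"
  proof (rule ccontr)
    assume "\<not> coprime ?t (ord x)"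
    then obtain q where q: "prime q" "q dvd ?t" "q dvd ord x"
      using prime_factor_nat[of "gcd ?t (ord x)"] by (auto simp: coprime_iff_gcd_eq_1)
    then have "q > p" using x(2) ord_pos[OF xc] by (auto simp: in_prime_factors_iff)
    show False
    proof (cases a)
      case 0 then show ?thesis using q a by simp
    next
      case (Suc b)
      then have "q dvd p ^ b * (p - 1)" using q a totient_prime_power_Suc[OF p] by simp
      then consider "q dvd p" | "q dvd p - 1" using q(1) prime_dvd_mult_iff prime_dvd_power by blast
      then show ?thesis using \<open>q > p\<close> prime_gt_1_nat[OF p] by cases (auto dest!: dvd_imp_le)
    qed
  qed
  have "conj_by x u \<in> U" using x(1) generate_self[of u] u(2) unfolding normalizer_in_def by blast
  then obtain j::nat where j: "conj_by x u = u [^] j" using u(2) generate_powers[OF uc] by auto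
  have "ord (u [^] j) = ord u" using ord_conj_by[OF xc uc] j by simp
  then have "coprime j (ord u)" using pow_ord_eq_ord_iff[OF finite_carrier uc] by simp
  then have "[j ^ ?t = 1] (mod ord u)" by (rule euler_theorem)
  then have "u [^] (j ^ ?t) = u" using pow_eq_cong[OF uc] uc by fastforce
  then have 1: "conj_by (x [^] ?t) u = u [^] (1::nat)" using conj_by_pow_left[OF xc uc j] uc by simp
  obtain k where "[?t * k = 1] (mod ord x)" using cong_solve_coprime_nat[OF cop] by auto
  then have "x [^] (?t * k) = x" using pow_eq_cong[OF xc] xc by fastforce
  moreover have "conj_by ((x [^] ?t) [^] k) u = u"
    using conj_by_pow_left[OF _ uc 1, of k] xc uc by simp
  ultimately have "conj_by x u = u" using xc by (simp add: nat_pow_pow)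
  then show ?thesis using generate_centralizer_in[OF H uc, of x] xH u(2) xc uc by (simp add: conj_by_eq_iff)
qed

lemma finite_conj_class: "subgroup H G \<Longrightarrow> finite (conj_class H U)"
  by (simp add: conj_class_def finite_subgroup)

lemma card_conj_class_pos: "subgroup H G \<Longrightarrow> U \<subseteq> carrier G \<Longrightarrow> card (conj_class H U) > 0"
  using conj_class_refl finite_conj_class card_gt_0_iff by blast

text \<open>Otherwise q divides the order of the normalizer, which by Cauchy contains an element of
  order q. As q > p this element centralizes U, so q would not be missing.\<close>

lemma missing_dvd_conj_class:
  assumes H: "subgroup H G" and p: "prime p" and U: "U \<in> cyclics {p} H" and \<sigma>: "primes_above p \<sigma>"
    and q: "q \<in> missing \<sigma> H U"
  shows "q dvd card (conj_class H U)"
proof (rule ccontr)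
  note UG = cyclics_carrier[OF H U]
  assume nd: "\<not> q dvd card (conj_class H U)"
  have qp: "prime q" "p < q" and qd: "q dvd card H" "\<not> q dvd card (centralizer_in H U)"
    using q \<sigma> by (auto simp: missing_def primes_above_def)
  have "q dvd card (normalizer_in H U)"
    using orbit_stabilizer[OF H UG] nd qd(1) qp(1) by (metis prime_dvd_mult_iff)
  then obtain x where x: "x \<in> normalizer_in H U" "ord x = q"
    using cauchy[OF normalizer_in_subgroup[OF H UG] qp(1)] by blast
  then have "x \<in> centralizer_in H U" using qp by (intro normalizer_in_imp_centralizer_in[OF H p U]) (auto simp: prime_prime_factors)
  then show False using ord_dvd_card[OF centralizer_in_subgroup[OF H UG]] x(2) qd(2) by blast
qed

lemma num_primes_split:
  assumes H: "subgroup H G" and U: "U \<subseteq> carrier G" and \<sigma>: "finite \<sigma>"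
  shows "num_primes \<sigma> H = num_primes \<sigma> (centralizer_in H U) + card (missing \<sigma> H U)"
proof -
  have "card (centralizer_in H U) dvd card H" using lagrange_subset[OF centralizer_in_subgroup[OF H U] H centralizer_in_subset] .
  then have "{q \<in> \<sigma>. q dvd card H} = {q \<in> \<sigma>. q dvd card (centralizer_in H U)} \<union> missing \<sigma> H U"
    by (auto simp: missing_def intro: dvd_trans)
  moreover have "{q \<in> \<sigma>. q dvd card (centralizer_in H U)} \<inter> missing \<sigma> H U = {}" by (auto simp: missing_def)
  ultimately show ?thesis unfolding num_primes_def using \<sigma> by (simp add: card_Un_disjoint missing_def)
qed

lemma conj_class_in_cyclics:
  assumes H: "subgroup H G" and U: "U \<in> cyclics \<tau> H" and V: "V \<in> conj_class H U"
  shows "V \<in> cyclics \<tau> H"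
proof -
  obtain h where h: "h \<in> H" "V = conj_by h ` U" using V by (auto simp: conj_class_def)
  obtain u where u: "u \<in> H" "U = generate G {u}" "prime_factors (ord u) \<subseteq> \<tau>" using U by (auto elim: cyclicsE)
  have c: "h \<in> carrier G" "u \<in> carrier G" using h u subgroup.mem_carrier[OF H] by auto
  have "conj_by h u \<in> H" using conj_by_image_subset[OF H h(1), of "{u}"] u(1) by simp
  then show ?thesis using cyclicsI[of "conj_by h u" H \<tau>] u c h(2) by (simp add: conj_by_generate ord_conj_by)
qed

lemma share_conj_class:
  assumes H: "subgroup H G" and U: "U \<subseteq> carrier G" and V: "V \<in> conj_class H U"
  shows "share \<sigma> H V = share \<sigma> H U"
proof -
  obtain h where h: "h \<in> H" "V = conj_by h ` U" using V by (auto simp: conj_class_def)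
  then show ?thesis
    using centralizer_in_conj_by[OF H h(1) U] card_cyclics_conj_by[OF _ centralizer_in_subgroup[OF H U], of h \<sigma>] subgroup.mem_carrier[OF H]
    by (simp add: share_def)
qed

lemma card_conj_class_member:
  assumes H: "subgroup H G" and U: "U \<subseteq> carrier G" and V: "V \<in> conj_class H U"
  shows "card V = card U"
  using assms card_conj_by subgroup.mem_carrier[OF H] by (auto simp: conj_class_def)

lemma sum_share_conj_class:
  assumes H: "subgroup H G" and U: "U \<subseteq> carrier G" and \<sigma>: "finite \<sigma>"
  shows "(\<Sum>V\<in>conj_class H U. share \<sigma> H V) = weight \<sigma> H U"
proof -
  have "(\<Sum>V\<in>conj_class H U. share \<sigma> H V) = real (card (conj_class H U)) * share \<sigma> H U"
    using share_conj_class[OF H U] by simp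
  also have "\<dots> = weight \<sigma> H U"
    using num_primes_split[OF H U \<sigma>] by (simp add: weight_def share_def eta_part_def power_add)
  finally show ?thesis .
qed

lemma centralizer_in_one: "subgroup H G \<Longrightarrow> centralizer_in H {\<one>} = H"
  by (auto simp: centralizer_in_def conj_by_def dest: subgroup.mem_carrier)

text \<open>The factor 2 accounts for p joining the primes counted in the denominator. The first
  summand is the contribution of the trivial p-subgroup, whose centralizer is all of
  \<open>H\<close>.\<close>

lemma eta_part_rec:
  assumes H: "subgroup H G" and p: "prime p" "p dvd card H" and \<sigma>: "primes_above p \<sigma>"
  shows "2 * eta_part (insert p \<sigma>) H = eta_part \<sigma> H + (\<Sum>U\<in>cyclics {p} H - {{\<one>}}. share \<sigma> H U)"
proof -
  have p\<sigma>: "p \<notin> \<sigma>" "finite \<sigma>" using \<sigma> by (auto simp: primes_above_def)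
  have "{q \<in> insert p \<sigma>. q dvd card H} = insert p {q \<in> \<sigma>. q dvd card H}" using p by auto
  then have k: "num_primes (insert p \<sigma>) H = Suc (num_primes \<sigma> H)" using p\<sigma> by (simp add: num_primes_def)
  have "real (card (cyclics (insert p \<sigma>) H)) = (\<Sum>U\<in>cyclics {p} H. real (card (cyclics \<sigma> (centralizer_in H U))))"
    using card_cyclics_insert[OF H p(1) p\<sigma>(1)] by simp
  also have "\<dots> = real (card (cyclics \<sigma> H)) + (\<Sum>U\<in>cyclics {p} H - {{\<one>}}. real (card (cyclics \<sigma> (centralizer_in H U))))"
    using sum.remove[OF finite_cyclics[OF H] one_in_cyclics[OF H], of "\<lambda>U. real (card (cyclics \<sigma> (centralizer_in H U)))" "{p}"] centralizer_in_one[OF H] by simp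
  finally show ?thesis
    by (simp add: eta_part_def share_def k add_divide_distrib flip: sum_divide_distrib)
qed

lemma cyclics_insert_not_dvd:
  assumes H: "subgroup H G" and "\<not> p dvd card H" shows "cyclics (insert p \<sigma>) H = cyclics \<sigma> H"
proof -
  have "p \<notin> prime_factors (ord x)" if "x \<in> H" for x
    using ord_dvd_card[OF H that] assms(2) by (auto simp: in_prime_factors_iff intro: dvd_trans)
  then show ?thesis by (auto simp: cyclics_def)
qed

lemma eta_part_not_dvd:
  assumes "subgroup H G" and "\<not> p dvd card H" shows "eta_part (insert p \<sigma>) H = eta_part \<sigma> H"
proof -
  have "{q \<in> insert p \<sigma>. q dvd card H} = {q \<in> \<sigma>. q dvd card H}" using assms by auto
  then show ?thesis using cyclics_insert_not_dvd[OF assms] by (simp add: eta_part_def num_primes_def)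
qed

lemma eta_part_empty: "subgroup H G \<Longrightarrow> eta_part {} H = 1"
  by (simp add: eta_part_def cyclics_empty num_primes_def)

lemma missing_finite: "finite \<sigma> \<Longrightarrow> finite (missing \<sigma> H U)"
  by (simp add: missing_def)

lemma weight_ratio_ge:
  assumes H: "subgroup H G" and p: "prime p" and U: "U \<in> cyclics {p} H" and \<sigma>: "primes_above p \<sigma>"
    and b: "\<And>q. q \<in> \<sigma> \<Longrightarrow> b \<le> q"
  shows "(real b / 2) ^ card (missing \<sigma> H U) \<le> real (card (conj_class H U)) / 2 ^ card (missing \<sigma> H U)"
  using \<sigma> b by (intro primes_prod_ratio_ge missing_dvd_conj_class[OF H p U \<sigma>] card_conj_class_pos[OF H cyclics_carrier[OF H U]])
    (auto simp: primes_above_def missing_def)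

lemma exists_order_p:
  assumes H: "subgroup H G" and p: "prime p" "p dvd card H"
  shows "\<exists>U\<in>cyclics {p} H - {{\<one>}}. card U = p"
proof -
  obtain x where x: "x \<in> H" "ord x = p" using cauchy[OF H p] by blast
  have xc: "x \<in> carrier G" using x(1) subgroup.mem_carrier[OF H] by blast
  have "card (generate G {x}) = p" using generate_pow_card[OF xc] x by simp
  moreover have "generate G {x} \<in> cyclics {p} H" using x p by (intro cyclicsI) (auto simp: prime_prime_factors)
  moreover have "generate G {x} \<noteq> {\<one>}" using calculation(1) p(1) by auto
  ultimately show ?thesis by blast
qed

lemma share_nonneg: "share \<sigma> H U \<ge> 0" by (simp add: share_def)

lemma conj_class_subset_nontriv:
  assumes H: "subgroup H G" and U: "U \<in> cyclics \<tau> H - {{\<one>}}" shows "conj_class H U \<subseteq> cyclics \<tau> H - {{\<one>}}"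
proof
  fix V assume V: "V \<in> conj_class H U"
  have UG: "U \<subseteq> carrier G" using U cyclics_carrier[OF H] by auto
  have "V \<noteq> {\<one>}"
  proof
    assume "V = {\<one>}"
    then have "U \<in> conj_class H {\<one>}" using conj_class_eq[OF H UG V] conj_class_refl[OF H UG] by simp
    then show False using U subgroup.mem_carrier[OF H] by (auto simp: conj_class_def conj_by_def)
  qed
  then show "V \<in> cyclics \<tau> H - {{\<one>}}" using conj_class_in_cyclics[OF H _ V] U by auto
qed

text \<open>The induction rule inserts an element below all earlier ones, so the primes are added in
  decreasing order. In the recursion both the trivial subgroup and the class of a subgroup of order
  p contribute at least 1.\<close>

lemma eta_part_ge_1:
  assumes "finite \<sigma>" "\<And>q. q \<in> \<sigma> \<Longrightarrow> prime q" "subgroup H G"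
  shows "eta_part \<sigma> H \<ge> 1"
  using assms
proof (induction \<sigma> arbitrary: H rule: finite_linorder_min_induct)
  case empty then show ?case by (simp add: eta_part_empty)
next
  case (insert p \<sigma>)
  have \<sigma>: "primes_above p \<sigma>" and p: "prime p" using insert by (auto simp: primes_above_def)
  have IH: "eta_part \<sigma> K \<ge> 1" if "subgroup K G" for K using insert that by auto
  note H = insert.prems(2)
  show ?case
  proof (cases "p dvd card H")
    case False then show ?thesis using eta_part_not_dvd[OF H] IH[OF H] by simp
  next
    case True
    let ?S = "cyclics {p} H - {{\<one>}}"
    obtain U where U: "U \<in> ?S" using exists_order_p[OF H p True] by blast
    then have Ucs: "U \<in> cyclics {p} H" and UG: "U \<subseteq> carrier G" using cyclics_carrier[OF H] by auto
    \<comment> \<open>With 2 as the lower bound for the primes in \<open>\<sigma>\<close>, the left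
      side is just 1.\<close>
    have "(real 2 / 2) ^ card (missing \<sigma> H U) \<le> real (card (conj_class H U)) / 2 ^ card (missing \<sigma> H U)"
      using \<sigma> by (intro weight_ratio_ge[OF H p Ucs \<sigma>]) (auto simp: primes_above_def prime_ge_2_nat)
    then have "1 * 1 \<le> weight \<sigma> H U"
      unfolding weight_def using IH[OF centralizer_in_subgroup[OF H UG]] by (intro mult_mono) auto
    also have "weight \<sigma> H U = (\<Sum>V\<in>conj_class H U. share \<sigma> H V)"
      using sum_share_conj_class[OF H UG] \<sigma> by (simp add: primes_above_def)
    also have "\<dots> \<le> (\<Sum>V\<in>?S. share \<sigma> H V)"
      using conj_class_subset_nontriv[OF H U] finite_cyclics[OF H] share_nonneg by (intro sum_mono2) auto
    finally show ?thesis using eta_part_rec[OF H p True \<sigma>] IH[OF H] by simp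
  qed
qed

lemma eta_part_ge_1_above:
  "primes_above p \<sigma> \<Longrightarrow> subgroup H G \<Longrightarrow> eta_part \<sigma> H \<ge> 1"
  using eta_part_ge_1[of \<sigma> H] by (auto simp: primes_above_def)

lemma weight_ge_ratio:
  assumes "subgroup H G" "U \<subseteq> carrier G" "primes_above p \<sigma>"
  shows "real (card (conj_class H U)) / 2 ^ card (missing \<sigma> H U) \<le> weight \<sigma> H U"
proof -
  have "real (card (conj_class H U)) / 2 ^ card (missing \<sigma> H U) * 1 \<le> weight \<sigma> H U"
    unfolding weight_def using eta_part_ge_1_above[OF assms(3) centralizer_in_subgroup[OF assms(1,2)]] by (intro mult_left_mono) auto
  then show ?thesis by simp
qed

lemma weight_ge:
  assumes H: "subgroup H G" and p: "prime p" and U: "U \<in> cyclics {p} H" and \<sigma>: "primes_above p \<sigma>"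
    and b: "\<And>q. q \<in> \<sigma> \<Longrightarrow> b \<le> q"
  shows "(real b / 2) ^ card (missing \<sigma> H U) \<le> weight \<sigma> H U"
  using weight_ratio_ge[OF H p U \<sigma> b] weight_ge_ratio[OF H cyclics_carrier[OF H U] \<sigma>] by linarith

lemma weight_ge_1:
  assumes H: "subgroup H G" and p: "prime p" and U: "U \<in> cyclics {p} H" and \<sigma>: "primes_above p \<sigma>"
  shows "weight \<sigma> H U \<ge> 1"
  using weight_ge[OF assms, of 2] \<sigma> by (auto simp: primes_above_def prime_ge_2_nat)

text \<open>A missing prime would divide the class size 1, so none is missing. Every element whose
  order involves only primes of \<open>\<sigma>\<close> normalizes, hence centralizes U, so
  \<open>H\<close> and the centralizer have the same cyclic subgroups to count.\<close>

lemma weight_normal: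
  assumes H: "subgroup H G" and p: "prime p" and U: "U \<in> cyclics {p} H" and \<sigma>: "primes_above p \<sigma>"
    and n: "card (conj_class H U) = 1"
  shows "weight \<sigma> H U = eta_part \<sigma> H"
proof -
  note UG = cyclics_carrier[OF H U]
  have M: "missing \<sigma> H U = {}"
  proof (rule ccontr)
    assume "missing \<sigma> H U \<noteq> {}"
    then obtain q where q: "q \<in> missing \<sigma> H U" by blast
    then have "prime q" "q dvd 1" using \<sigma> missing_dvd_conj_class[OF H p U \<sigma> q] n by (auto simp: missing_def primes_above_def)
    then show False by simp
  qed
  have "normalizer_in H U = H" using card_conj_class_eq_1[OF H UG] n by simp
  then have "x \<in> centralizer_in H U" if "x \<in> H" "prime_factors (ord x) \<subseteq> \<sigma>" for x
    using normalizer_in_imp_centralizer_in[OF H p U, of x] that \<sigma> by (auto simp: primes_above_def)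
  then have "cyclics \<sigma> (centralizer_in H U) = cyclics \<sigma> H" using centralizer_in_subset[of H U] unfolding cyclics_def by blast
  then show ?thesis using num_primes_split[OF H UG, of \<sigma>] M n \<sigma> by (simp add: weight_def eta_part_def primes_above_def)
qed

text \<open>One, two, or at least three classes. From three classes on a lower bound is enough:
  weights of at least 1, together with the term for the trivial subgroup, already make the right
  side of the recursion at least 4.\<close>

lemma orbit_cases:
  assumes H: "subgroup H G" and U: "U \<in> cyclics {p} H - {{\<one>}}" and \<sigma>: "finite \<sigma>"
  defines "S \<equiv> cyclics {p} H - {{\<one>}}" and "T \<equiv> (\<Sum>U\<in>cyclics {p} H - {{\<one>}}. share \<sigma> H U)"
  obtains "S = conj_class H U" "T = weight \<sigma> H U"
  | V where "V \<in> S" "V \<notin> conj_class H U" "T = weight \<sigma> H U + weight \<sigma> H V"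
  | V W where "V \<in> S" "W \<in> S" "V \<notin> conj_class H U" "T \<ge> weight \<sigma> H U + weight \<sigma> H V + weight \<sigma> H W"
proof -
  have fin: "finite S" using finite_cyclics[OF H] S_def by simp
  have SG: "V \<subseteq> carrier G" if "V \<in> S" for V using that cyclics_carrier[OF H] S_def by auto
  have sub: "conj_class H V \<subseteq> S" if "V \<in> S" for V using conj_class_subset_nontriv[OF H] that S_def by auto
  have disj: "conj_class H V \<inter> conj_class H W = {}" if "V \<in> S" "W \<in> S" "W \<notin> conj_class H V" for V W
    using conj_class_disjoint[OF H SG SG] that by blast
  have ws: "(\<Sum>W\<in>conj_class H V. share \<sigma> H W) = weight \<sigma> H V" if "V \<in> S" for V
    using sum_share_conj_class[OF H SG[OF that] \<sigma>] .
  have fo: "finite (conj_class H V)" for V using finite_conj_class[OF H] .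
  have US: "U \<in> S" using U S_def by simp
  have TS: "T = sum (share \<sigma> H) S" by (simp add: T_def S_def)
  show ?thesis
  proof (cases "S = conj_class H U")
    case True then show ?thesis using that(1) ws[OF US] TS by simp
  next
    case False
    then obtain V where V: "V \<in> S" "V \<notin> conj_class H U" using sub[OF US] by blast
    have UV: "(\<Sum>W\<in>conj_class H U \<union> conj_class H V. share \<sigma> H W) = weight \<sigma> H U + weight \<sigma> H V"
      using sum.union_disjoint[OF fo fo disj[OF US V], of "share \<sigma> H"] ws[OF US] ws[OF V(1)] by simp
    show ?thesis
    proof (cases "S = conj_class H U \<union> conj_class H V")
      case True then show ?thesis using that(2)[OF V] UV TS by simp
    next
      case False
      then obtain W where W: "W \<in> S" "W \<notin> conj_class H U" "W \<notin> conj_class H V" using sub US V by blast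
      have "(conj_class H U \<union> conj_class H V) \<inter> conj_class H W = {}" using disj US V W by blast
      then have "(\<Sum>X\<in>(conj_class H U \<union> conj_class H V) \<union> conj_class H W. share \<sigma> H X) = weight \<sigma> H U + weight \<sigma> H V + weight \<sigma> H W"
        using sum.union_disjoint[of "conj_class H U \<union> conj_class H V" "conj_class H W" "share \<sigma> H"] fo ws W UV by simp
      moreover have "(\<Sum>X\<in>(conj_class H U \<union> conj_class H V) \<union> conj_class H W. share \<sigma> H X) \<le> T"
        unfolding TS using fin sub[OF US] sub[OF V(1)] sub[OF W(1)] share_nonneg by (intro sum_mono2) auto
      ultimately show ?thesis using that(3)[OF V(1) W(1) V(2)] by simp
    qed
  qed
qed

end

section \<open>Subgroups of prime order; the odd case\<close>

text \<open>All cycles of f have length p. If a point returned after 0 < d < p steps, then d would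
  be invertible modulo p, so f, being a power of its d-th iterate at that point, would fix the
  point.\<close>

lemma prime_dvd_card_of_free_perm:
  assumes fin: "finite X" and p: "prime p"
    and X: "\<And>x. x \<in> X \<Longrightarrow> f x \<in> X" and id: "\<And>x. x \<in> X \<Longrightarrow> (f ^^ p) x = x" and free: "\<And>x. x \<in> X \<Longrightarrow> f x \<noteq> x"
  shows "p dvd card X"
proof -
  define cycle where "cycle x = (\<lambda>i. (f ^^ i) x) ` {..<p}" for x
  have p0: "p > 1" using p prime_gt_1_nat by blast
  have Xi: "(f ^^ i) x \<in> X" if "x \<in> X" for x i using that X by (induction i) auto
  have md: "(f ^^ (i mod p)) x = (f ^^ i) x" if "x \<in> X" for x i using funpow_mod_eq[OF id[OF that]] .
  have inj: False if x: "x \<in> X" and ij: "i < j" "j < p" "(f ^^ i) x = (f ^^ j) x" for x i j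
  proof -
    let ?y = "(f ^^ i) x" and ?d = "j - i"
    have y: "?y \<in> X" using Xi x .
    have d: "(f ^^ ?d) ?y = ?y"
      using ij funpow_add[of ?d i f] by simp
    have "coprime ?d p" using p ij by (metis coprime_commute diff_is_0_eq' less_imp_diff_less linorder_not_less
          nat_dvd_not_less prime_imp_coprime zero_less_diff)
    then obtain k where k: "[?d * k = 1] (mod p)" using cong_solve_coprime_nat by auto
    have "(f ^^ (?d * k)) ?y = ?y" using d by (induction k) (simp_all add: funpow_add)
    moreover have "(f ^^ (?d * k)) ?y = f ?y" using md[OF y, of "?d * k"] k p0 by (simp add: cong_def)
    ultimately show False using free[OF y] by simp
  qed
  have card: "card (cycle x) = p" if "x \<in> X" for x
  proof -
    have "inj_on (\<lambda>i. (f ^^ i) x) {..<p}"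
    proof (rule inj_onI)
      fix i j assume "i \<in> {..<p}" "j \<in> {..<p}" "(f ^^ i) x = (f ^^ j) x"
      then show "i = j" using inj[OF that, of i j] inj[OF that, of j i] by (cases i j rule: linorder_cases) auto
    qed
    then show ?thesis by (simp add: cycle_def card_image)
  qed
  have eq: "cycle y = cycle x" if x: "x \<in> X" and y: "y \<in> cycle x" for x y
  proof -
    obtain i where i: "y = (f ^^ i) x" using y by (auto simp: cycle_def)
    have "(f ^^ j) y \<in> cycle x" for j
    proof -
      have "(f ^^ j) y = (f ^^ ((j + i) mod p)) x" using md[OF x] i by (simp add: funpow_add)
      then show ?thesis using p0 by (auto simp: cycle_def)
    qed
    then have "cycle y \<subseteq> cycle x" by (auto simp: cycle_def[of y])
    moreover have "y \<in> X" using Xi x i by simp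
    ultimately show ?thesis using card x by (intro card_subset_eq) (auto simp: cycle_def)
  qed
  have self: "x \<in> cycle x" for x using p0 by (auto simp: cycle_def intro!: image_eqI[of _ _ 0])
  have U: "\<Union>(cycle ` X) = X" using self Xi by (auto simp: cycle_def)
  have "p dvd card (\<Union>(cycle ` X))"
  proof (rule dvd_partition)
    show "finite (\<Union>(cycle ` X))" using U fin by simp
    show "\<forall>c\<in>cycle ` X. p dvd card c" using card by auto
    show "\<forall>c1\<in>cycle ` X. \<forall>c2\<in>cycle ` X. c1 \<noteq> c2 \<longrightarrow> c1 \<inter> c2 = {}" using eq by blast
  qed
  then show ?thesis using U by simp
qed

context finite_group
begin

lemma order_p_generate:
  assumes p: "prime p" and U: "subgroup U G" "card U = p" and x: "x \<in> U" "x \<noteq> \<one>"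
  shows "generate G {x} = U" "ord x = p"
proof -
  have xc: "x \<in> carrier G" using subgroup.mem_carrier[OF U(1) x(1)] .
  have "ord x dvd p" using ord_dvd_card[OF U(1) x(1)] U(2) by simp
  moreover have "ord x \<noteq> 1" using x(2) ord_eq_1[OF xc] by simp
  ultimately show o: "ord x = p" using p by (auto simp: prime_nat_iff)
  show "generate G {x} = U"
    using generate_single_subset[OF U(1) x(1)] generate_pow_card[OF xc] o U(2) finite_subgroup[OF U(1)]
    by (intro card_subset_eq) auto
qed

text \<open>The count of McKay's proof of Cauchy's theorem: left translation by an element of order \<open>p\<close>
  on its centralizer and conjugation by it elsewhere is a free action of order \<open>p\<close> on the solutions of
  \<open>x\<^sup>p = 1\<close>.\<close>

lemma dvd_card_order_p_subgroups:
  assumes H: "subgroup H G" and p: "prime p" "p dvd card H"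
  shows "p dvd card {U \<in> cyclics {p} H. card U = p} - 1"
proof -
  let ?N = "{U \<in> cyclics {p} H. card U = p}"
  let ?X = "{x \<in> H. x [^] p = \<one>}"
  obtain u where u: "u \<in> H" "ord u = p" using cauchy[OF H p] by blast
  have HG: "x \<in> carrier G" if "x \<in> H" for x using subgroup.mem_carrier[OF H that] .
  have uc: "u \<in> carrier G" using HG[OF u(1)] .
  have up: "u [^] p = \<one>" using pow_ord_eq_1[OF uc] u(2) by simp
  have u1: "u \<noteq> \<one>" using u(2) p(1) by auto
  define f where "f x = (if conj_by u x = x then u \<otimes> x else conj_by u x)" for x
  have fix_mult: "conj_by u (u [^] i \<otimes> x) = u [^] i \<otimes> x" if "conj_by u x = x" "x \<in> carrier G" for x and i :: nat
    using that uc by (simp add: conj_by_distrib conj_by_pow) (simp add: conj_by_def m_assoc)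
  have f1: "(f ^^ i) x = u [^] i \<otimes> x" if "conj_by u x = x" "x \<in> carrier G" for x and i :: nat
  proof (induction i)
    case 0 then show ?case using that by simp
  next
    case (Suc i)
    have "(f ^^ Suc i) x = f (u [^] i \<otimes> x)" using Suc by simp
    also have "\<dots> = u \<otimes> (u [^] i \<otimes> x)" using fix_mult[OF that] by (simp add: f_def)
    also have "\<dots> = u [^] Suc i \<otimes> x" using uc that by (simp add: m_assoc[symmetric] nat_pow_Suc2[symmetric])
    finally show ?case .
  qed
  have f2: "(f ^^ i) x = conj_by (u [^] i) x" if "conj_by u x \<noteq> x" "x \<in> carrier G" for x and i :: nat
  proof (induction i)
    case 0 then show ?case using that by simp
  next
    case (Suc i)
    have sw: "conj_by u (conj_by (u [^] i) x) = conj_by (u [^] i) (conj_by u x)"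
      using uc that by (simp add: conj_by_mult[symmetric] nat_pow_Suc2[symmetric])
    have "conj_by (u [^] i) (conj_by u x) \<noteq> conj_by (u [^] i) x"
      using inj_on_conj_by[of "u [^] i"] uc that by (auto simp: inj_on_def)
    then have "f (conj_by (u [^] i) x) = conj_by u (conj_by (u [^] i) x)" using sw by (simp add: f_def)
    then have "(f ^^ Suc i) x = conj_by u (conj_by (u [^] i) x)" using Suc by simp
    also have "\<dots> = conj_by (u [^] Suc i) x" using sw uc that by (simp add: conj_by_mult)
    finally show ?case .
  qed
  have "p dvd card ?X"
  proof (rule prime_dvd_card_of_free_perm[OF _ p(1), of _ f])
    show "finite ?X" using finite_subgroup[OF H] by simp
    fix x assume x: "x \<in> ?X"
    then have xc: "x \<in> carrier G" using HG by simp
    show "(f ^^ p) x = x" using f1[of x p] f2[of x p] up xc by (cases "conj_by u x = x") auto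
    show "f x \<noteq> x" using u1 uc xc by (auto simp: f_def)
    have "conj_by u x \<in> H" using conj_by_image_subset[OF H u(1), of "{x}"] x by simp
    moreover have "(u \<otimes> x) [^] p = \<one>" if "conj_by u x = x"
    proof -
      have "u \<otimes> x = x \<otimes> u" using that uc xc by (simp add: conj_by_eq_iff)
      from pow_mult_distrib[OF this uc xc, of p] show ?thesis using up x by simp
    qed
    moreover have "conj_by u x [^] p = \<one>" using conj_by_pow[OF uc xc, of p] x uc by (simp add: conj_by_def)
    ultimately show "f x \<in> ?X" using x u(1) subgroup.m_closed[OF H] by (auto simp: f_def)
  qed
  \<comment> \<open>Subgroups of order p meet pairwise trivially, since any nontrivial element
    generates the one containing it; each contributes p - 1 solutions besides the identity.\<close>
  also have "card ?X = 1 + card ?N * (p - 1)"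
  proof -
    have Usub: "subgroup U G" "U \<subseteq> H" if "U \<in> ?N" for U using that cyclics_subgroup[OF H, of U "{p}"] cyclics_subset[OF H, of U "{p}"] by auto
    have e: "?X = insert \<one> (\<Union>U\<in>?N. U - {\<one>})"
    proof (intro subset_antisym subsetI)
      fix x assume x: "x \<in> ?X"
      then have xc: "x \<in> carrier G" using HG by simp
      have "x \<in> (\<Union>U\<in>?N. U - {\<one>})" if "x \<noteq> \<one>"
      proof -
        have "ord x dvd p" using x xc by (simp add: pow_eq_id)
        then have "ord x = p" using that ord_eq_1[OF xc] p(1) by (auto simp: prime_nat_iff)
        then have "generate G {x} \<in> ?N" using cyclicsI[of x H "{p}"] x xc p(1) generate_pow_card[OF xc]
          by (auto simp: prime_prime_factors)
        then show ?thesis using that generate_self[of x] by blast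
      qed
      then show "x \<in> insert \<one> (\<Union>U\<in>?N. U - {\<one>})" by blast
    next
      fix x assume "x \<in> insert \<one> (\<Union>U\<in>?N. U - {\<one>})"
      then consider "x = \<one>" | U where "U \<in> ?N" "x \<in> U" "x \<noteq> \<one>" by blast
      then show "x \<in> ?X"
      proof cases
        case 1 then show ?thesis using subgroup.one_closed[OF H] by simp
      next
        case (2 U)
        then have "ord x = p" using order_p_generate(2)[OF p(1) Usub(1)] by blast
        moreover have "x \<in> H" using 2 Usub(2) by blast
        ultimately show ?thesis using HG pow_ord_eq_1[of x] by auto
      qed
    qed
    have "card (\<Union>U\<in>?N. U - {\<one>}) = (\<Sum>U\<in>?N. card (U - {\<one>}))"
    proof (rule card_UN_disjoint)
      show "finite ?N" using finite_cyclics[OF H] by simp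
      show "\<forall>U\<in>?N. finite (U - {\<one>})" using Usub finite_subgroup by blast
      show "\<forall>U\<in>?N. \<forall>V\<in>?N. U \<noteq> V \<longrightarrow> (U - {\<one>}) \<inter> (V - {\<one>}) = {}"
        using order_p_generate(1)[OF p(1) Usub(1)] by blast
    qed
    moreover have "card (U - {\<one>}) = p - 1" if "U \<in> ?N" for U
      using that subgroup.one_closed[OF Usub(1)[OF that]] finite_subgroup[OF Usub(1)[OF that]] by simp
    ultimately have "card (\<Union>U\<in>?N. U - {\<one>}) = card ?N * (p - 1)" by simp
    moreover have "finite (\<Union>U\<in>?N. U - {\<one>})" using Usub(2) finite_subset[OF _ finite_subgroup[OF H]] by (meson Diff_subset UN_least subset_trans)
    moreover have "\<one> \<notin> (\<Union>U\<in>?N. U - {\<one>})" by blast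
    ultimately show ?thesis unfolding e using card_insert_disjoint[of "\<Union>U\<in>?N. U - {\<one>}" \<one>] by linarith
  qed
  finally have d: "p dvd 1 + card ?N * (p - 1)" .
  have "card ?N \<ge> 1" using exists_order_p[OF H p] finite_cyclics[OF H]
    by (auto simp: Suc_le_eq card_gt_0_iff)
  have "p \<ge> 1" using prime_ge_1_nat[OF p(1)] .
  \<comment> \<open>The subtraction of naturals does not truncate, because there is at least one
    subgroup of order p.\<close>
  have "card ?N * p - (1 + card ?N * (p - 1)) = card ?N - 1"
    using \<open>p \<ge> 1\<close> \<open>card ?N \<ge> 1\<close> by (simp add: diff_mult_distrib2)
  moreover have "p dvd card ?N * p - (1 + card ?N * (p - 1))" using d by (intro dvd_diff_nat) auto
  ultimately show ?thesis by simp
qed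

section \<open>Class sizes, weights and the values for odd primes\<close>

text \<open>Conjugates have equal size and some member has order p by Cauchy, so the single class is
  exactly the set of subgroups of order p, whose number is 1 modulo p.\<close>

lemma single_orbit:
  assumes H: "subgroup H G" and p: "prime p" "p dvd card H" and U: "U \<in> cyclics {p} H - {{\<one>}}"
    and S: "cyclics {p} H - {{\<one>}} = conj_class H U"
  shows "card U = p" "p dvd card (conj_class H U) - 1"
proof -
  have UG: "U \<subseteq> carrier G" using U cyclics_carrier[OF H] by auto
  obtain V where V: "V \<in> cyclics {p} H - {{\<one>}}" "card V = p" using exists_order_p[OF H p] by blast
  then show "card U = p" using card_conj_class_member[OF H UG, of V] S by simp
  have "{U \<in> cyclics {p} H. card U = p} = conj_class H U"
  proof (intro subset_antisym subsetI)
    fix W assume "W \<in> {U \<in> cyclics {p} H. card U = p}"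
    then have "W \<in> cyclics {p} H - {{\<one>}}" using p(1) by auto
    then show "W \<in> conj_class H U" using S by simp
  next
    fix W assume W: "W \<in> conj_class H U"
    then have "W \<in> cyclics {p} H - {{\<one>}}" using S by simp
    then show "W \<in> {U \<in> cyclics {p} H. card U = p}" using card_conj_class_member[OF H UG W] \<open>card U = p\<close> by simp
  qed
  then show "p dvd card (conj_class H U) - 1" using dvd_card_order_p_subgroups[OF H p] by simp
qed

text \<open>Without missing primes the class size, at least 2, counts in full; each missing prime
  contributes at least b / 2. The bound is used with b = 3 for the prime 2, giving 3/2, and with b =
  5 for odd primes, giving 2.\<close>

lemma weight_ge_not_normal:
  assumes H: "subgroup H G" and p: "prime p" and U: "U \<in> cyclics {p} H" and \<sigma>: "primes_above p \<sigma>"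
    and n: "card (conj_class H U) \<noteq> 1" and b: "\<And>q. q \<in> \<sigma> \<Longrightarrow> b \<le> q" "3 \<le> b"
  shows "min 2 (real b / 2) \<le> weight \<sigma> H U"
proof (cases "missing \<sigma> H U = {}")
  case True
  have "card (conj_class H U) \<ge> 2" using n card_conj_class_pos[OF H cyclics_carrier[OF H U]] by linarith
  then show ?thesis using weight_ge_ratio[OF H cyclics_carrier[OF H U] \<sigma>] True by simp
next
  case False
  then have "card (missing \<sigma> H U) \<ge> 1"
    using missing_finite[of \<sigma> H U] \<sigma> by (auto simp: primes_above_def Suc_le_eq card_gt_0_iff)
  then have "(real b / 2) ^ 1 \<le> (real b / 2) ^ card (missing \<sigma> H U)" using b(2) by (intro power_increasing) auto
  then show ?thesis using weight_ge[OF H p U \<sigma> b(1)] by simp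
qed

lemma missing_cases:
  assumes H: "subgroup H G" and p: "prime p" and U: "U \<in> cyclics {p} H" and \<sigma>: "primes_above p \<sigma>"
  obtains "missing \<sigma> H U = {}"
  | q where "missing \<sigma> H U = {q}" "q \<in> \<sigma>" "q dvd card (conj_class H U)"
  | "2 \<le> card (missing \<sigma> H U)"
proof -
  have fin: "finite (missing \<sigma> H U)" using missing_finite \<sigma> by (simp add: primes_above_def)
  consider "card (missing \<sigma> H U) = 0" | "card (missing \<sigma> H U) = 1" | "2 \<le> card (missing \<sigma> H U)" by linarith
  then show ?thesis
  proof cases
    case 2
    then obtain q where q: "missing \<sigma> H U = {q}" using card_1_singletonE by blast
    then show ?thesis using that(2)[OF q] missing_dvd_conj_class[OF H p U \<sigma>, of q] by (auto simp: missing_def)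
  qed (use fin that in auto)
qed

text \<open>Above an odd p all primes are at least 5, so every nonnormal class weighs at least 2.
  Below 2 this leaves one normal class, which keeps the old value, or two normal classes, which
  multiply it by 3/2.\<close>

lemma eta_part_odd:
  assumes "finite \<sigma>" "\<And>q. q \<in> \<sigma> \<Longrightarrow> prime q \<and> 2 < q" "subgroup H G"
  shows "eta_part \<sigma> H = 1 \<or> eta_part \<sigma> H = 3/2 \<or> eta_part \<sigma> H \<ge> 2"
  using assms
proof (induction \<sigma> arbitrary: H rule: finite_linorder_min_induct)
  case empty then show ?case by (simp add: eta_part_empty)
next
  case (insert p \<sigma>)
  have \<sigma>: "primes_above p \<sigma>" "finite \<sigma>" and p: "prime p" "2 < p" using insert by (auto simp: primes_above_def)
  note H = insert.prems(2)
  have IH: "eta_part \<sigma> H = 1 \<or> eta_part \<sigma> H = 3/2 \<or> eta_part \<sigma> H \<ge> 2" using insert by auto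
  have r1: "eta_part \<sigma> H \<ge> 1" using eta_part_ge_1_above[OF \<sigma>(1) H] .
  have b: "5 \<le> q" if "q \<in> \<sigma>" for q
  proof -
    have "prime q" "3 < q" using \<sigma> p that by (auto simp: primes_above_def)
    moreover have "\<not> prime (4::nat)" by (simp add: prime_nat_iff) (rule exI[of _ 2], simp)
    ultimately have "q \<noteq> 4" by auto
    then show ?thesis using \<open>3 < q\<close> by simp
  qed
  show ?case
  proof (cases "p dvd card H")
    case False then show ?thesis using eta_part_not_dvd[OF H] IH by simp
  next
    case True
    let ?S = "cyclics {p} H - {{\<one>}}"
    define T where "T = (\<Sum>U\<in>?S. share \<sigma> H U)"
    have rec: "2 * eta_part (insert p \<sigma>) H = eta_part \<sigma> H + T"
      using eta_part_rec[OF H p(1) True \<sigma>(1)] T_def by simp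
    have w1: "weight \<sigma> H V \<ge> 1" if "V \<in> ?S" for V using weight_ge_1[OF H p(1) _ \<sigma>(1)] that by auto
    have w2: "weight \<sigma> H V \<ge> 2" if "V \<in> ?S" "card (conj_class H V) \<noteq> 1" for V
      using weight_ge_not_normal[OF H p(1) _ \<sigma>(1) that(2) b] that(1) by auto
    show ?thesis
    proof (cases "\<exists>U\<in>?S. card (conj_class H U) = 1")
      case True
      then obtain U where U: "U \<in> ?S" "card (conj_class H U) = 1" by blast
      have wU: "weight \<sigma> H U = eta_part \<sigma> H" using weight_normal[OF H p(1) _ \<sigma>(1) U(2)] U(1) by auto
      show ?thesis
      proof (cases rule: orbit_cases[OF H U(1) \<sigma>(2)])
        case 1 then show ?thesis using rec wU IH T_def by auto
      next
        case (2 V)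
        then have V: "V \<in> ?S" "T = eta_part \<sigma> H + weight \<sigma> H V" using wU T_def by auto
        show ?thesis
        proof (cases "card (conj_class H V) = 1")
          case True
          then have "weight \<sigma> H V = eta_part \<sigma> H" using weight_normal[OF H p(1) _ \<sigma>(1) True] V(1) by auto
          then show ?thesis using rec V IH by auto
        next
          case False then show ?thesis using rec V w2[OF V(1)] r1 by auto
        qed
      next
        case (3 V W)
        then have "T \<ge> eta_part \<sigma> H + 1 + 1" using w1[of V] w1[of W] wU T_def by auto
        then show ?thesis using rec r1 by auto
      qed
    next
      case False
      then have w: "weight \<sigma> H V \<ge> 2" if "V \<in> ?S" for V using w2 that by auto
      obtain U where U: "U \<in> ?S" using exists_order_p[OF H p(1) True] by blast
      then have Uc: "U \<in> cyclics {p} H" by auto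
      have m1: "card (conj_class H U) \<noteq> 1" using False U by auto
      show ?thesis
      proof (cases rule: orbit_cases[OF H U \<sigma>(2)])
        case 1
        have pm: "p dvd card (conj_class H U) - 1" using single_orbit(2)[OF H p(1) True U 1(1)] .
        then have m: "card (conj_class H U) \<ge> p + 1"
          using m1 card_conj_class_pos[OF H cyclics_carrier[OF H Uc]] dvd_imp_le[of p "card (conj_class H U) - 1"] by linarith
        \<comment> \<open>Together with the old value, at least 1, a weight of 3 brings the right
          side of the recursion to 4.\<close>
        have "weight \<sigma> H U \<ge> 3"
        proof (cases rule: missing_cases[OF H p(1) Uc \<sigma>(1)])
          case 1
          then show ?thesis using weight_ge_ratio[OF H cyclics_carrier[OF H Uc] \<sigma>(1)] m p(2) by simp
        next
          case (2 q)
          have "card (conj_class H U) \<ge> 5" using dvd_imp_le[OF 2(3)] m b[OF 2(2)] by linarith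
          \<comment> \<open>With one missing prime the class needs at least 6 members to weigh 3.
            Size 5 is excluded because the odd prime p divides the size minus 1, here 4.\<close>
          moreover have "card (conj_class H U) \<noteq> 5"
          proof
            assume "card (conj_class H U) = 5"
            then have "p dvd 2 ^ 2" using pm by simp
            then have "p dvd 2" using p(1) prime_dvd_power by blast
            then show False using p(2) by (auto dest: dvd_imp_le)
          qed
          ultimately show ?thesis using weight_ge_ratio[OF H cyclics_carrier[OF H Uc] \<sigma>(1)] 2(1) by simp
        next
          case 3
          then have "(real 5 / 2) ^ 2 \<le> (real 5 / 2) ^ card (missing \<sigma> H U)" by (intro power_increasing) auto
          then show ?thesis using weight_ge[OF H p(1) Uc \<sigma>(1) b] by (simp add: power2_eq_square)
        qed
        then show ?thesis using rec r1 1 T_def by auto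
      next
        case (2 V)
        then show ?thesis using rec r1 w[of U] w[of V] U T_def by auto
      next
        case (3 V W)
        then show ?thesis using rec r1 w[of U] w[of V] w[of W] U T_def by auto
      qed
    qed
  qed
qed

end

section \<open>The prime two\<close>

lemma (in group) pow_index_in_normal:
  assumes N: "N \<lhd> G" and x: "x \<in> carrier G"
  shows "x [^] card (rcosets N) \<in> N"
proof -
  interpret N: normal N G by (rule N)
  interpret Q: group "G Mod N" by (rule N.factorgroup_is_group)
  interpret h: group_hom G "G Mod N" "\<lambda>a. N #> a"
    by (unfold_locales) (rule N.r_coset_hom_Mod)
  have "N #> (x [^] card (rcosets N)) = (N #> x) [^]\<^bsub>G Mod N\<^esub> order (G Mod N)"
    using h.hom_nat_pow[OF x] by (simp add: order_def FactGroup_def)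
  also have "\<dots> = \<one>\<^bsub>G Mod N\<^esub>" using Q.pow_order_eq_1[OF h.hom_closed[OF x]] .
  finally have "N #> (x [^] card (rcosets N)) = N" by simp
  then show ?thesis using coset_join1[OF _ _ N.subgroup_axioms] x N.subset by simp
qed

section \<open>Three involutions in one class\<close>

context finite_group
begin

text \<open>Lagrange in the quotient of \<open>H\<close> by T. It serves to trap elements: if
  \<open>ord x\<close> is coprime to the index n, then x is a power of x^n and lies in T
  itself.\<close>

lemma pow_index_mem:
  assumes H: "subgroup H G" and T: "subgroup T G" "T \<subseteq> H" "normalizer_in H T = H" and n: "card H = n * card T"
    and x: "x \<in> H"
  shows "x [^] n \<in> T"
proof -
  interpret K: group "G\<lparr>carrier := H\<rparr>" using subgroup_imp_group[OF H] .
  have TK: "subgroup T (G\<lparr>carrier := H\<rparr>)" using subgroup_incl[OF T(1) H T(2)] .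
  have "h \<otimes> t \<otimes> inv h \<in> T" if "h \<in> H" "t \<in> T" for h t
  proof -
    have "conj_by h ` T = T" using that T(3) by (auto simp: normalizer_in_def)
    then show ?thesis using that(2) unfolding conj_by_def by blast
  qed
  then have N: "T \<lhd> (G\<lparr>carrier := H\<rparr>)"
    using TK m_inv_consistent[OF H] by (simp add: K.normal_inv_iff)
  have "card (rcosets\<^bsub>G\<lparr>carrier := H\<rparr>\<^esub> T) * card T = card H"
    using K.lagrange[OF TK] by (simp add: order_def)
  then have "card (rcosets\<^bsub>G\<lparr>carrier := H\<rparr>\<^esub> T) = n"
    using n card_subgroup_pos[OF T(1)] by simp
  then show ?thesis using K.pow_index_in_normal[OF N, of x] x by (simp flip: nat_pow_consistent)
qed

lemma generate_involution:
  assumes "x \<in> carrier G" "ord x = 2" shows "generate G {x} = {\<one>, x}"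
proof -
  have "x \<noteq> \<one>" using assms by auto
  then have "card {\<one>, x} = card (generate G {x})" using assms generate_pow_card[of x] by simp
  moreover have "{\<one>, x} \<subseteq> generate G {x}"
    using generate_self[of x] subgroup.one_closed[OF generate_single_subgroup[OF assms(1)]] by simp
  ultimately show ?thesis
    using finite_subgroup[OF generate_single_subgroup[OF assms(1)]] card_subset_eq by metis
qed

text \<open>A group of order 2 has exactly one involution, so the class may be handled as a set of
  elements, which can be multiplied.\<close>

lemma involutions_bij:
  assumes H: "subgroup H G" and U: "U \<in> cyclics {2} H - {{\<one>}}"
    and S: "cyclics {2} H - {{\<one>}} = conj_class H U" and c: "card U = 2"
  shows "bij_betw (\<lambda>x. generate G {x}) {x \<in> H. ord x = 2} (conj_class H U)"
proof (rule bij_betw_imageI)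
  have UG: "U \<subseteq> carrier G" using U cyclics_carrier[OF H] by auto
  note HG = subgroup.mem_carrier[OF H]
  show "inj_on (\<lambda>x. generate G {x}) {x \<in> H. ord x = 2}"
  proof (rule inj_onI)
    fix x y assume xy: "x \<in> {x \<in> H. ord x = 2}" "y \<in> {x \<in> H. ord x = 2}" "generate G {x} = generate G {y}"
    then have "{\<one>, x} = {\<one>, y}" using generate_involution[of x] generate_involution[of y] HG by auto
    moreover have "x \<noteq> \<one>" "y \<noteq> \<one>" using xy by auto
    ultimately show "x = y" by (auto simp: doubleton_eq_iff)
  qed
  show "(\<lambda>x. generate G {x}) ` {x \<in> H. ord x = 2} = conj_class H U"
  proof (intro subset_antisym subsetI)
    fix V assume "V \<in> (\<lambda>x. generate G {x}) ` {x \<in> H. ord x = 2}"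
    then obtain x where x: "x \<in> H" "ord x = 2" "V = generate G {x}" by auto
    have "V \<in> cyclics {2} H" using cyclicsI[of x H "{2}"] x by (simp add: prime_prime_factors)
    moreover have "V \<noteq> {\<one>}" using x generate_self[of x] by auto
    ultimately show "V \<in> conj_class H U" using S by auto
  next
    fix V assume V: "V \<in> conj_class H U"
    then have "V \<in> cyclics {2} H" using S by auto
    then obtain x where x: "x \<in> H" "V = generate G {x}" by (auto elim: cyclicsE)
    have "ord x = 2" using card_conj_class_member[OF H UG V] c x generate_pow_card[OF HG[OF x(1)]] by simp
    then show "V \<in> (\<lambda>x. generate G {x}) ` {x \<in> H. ord x = 2}" using x by auto
  qed
qed

lemma card_centralizer_in_conj_class:
  assumes H: "subgroup H G" and U: "U \<subseteq> carrier G" and V: "V \<in> conj_class H U"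
  shows "card (centralizer_in H V) = card (centralizer_in H U)"
proof -
  obtain h where h: "h \<in> H" "V = conj_by h ` U" using V by (auto simp: conj_class_def)
  have "centralizer_in H U \<subseteq> carrier G" using subgroup.subset[OF centralizer_in_subgroup[OF H U]] .
  then show ?thesis using centralizer_in_conj_by[OF H h(1) U] card_conj_by subgroup.mem_carrier[OF H h(1)] h(2) by simp
qed

text \<open>The involutions behave as the transpositions of S_3, and T plays the part of its
  rotation subgroup. T is normal because conjugation permutes the three involutions and T contains
  all products of two distinct ones.\<close>

lemma three_noncommuting_involutions:
  assumes H: "subgroup H G" and I: "card {x \<in> H. ord x = 2} = 3"
    and ab: "a \<in> H" "ord a = 2" "b \<in> H" "ord b = 2" "a \<otimes> b \<noteq> b \<otimes> a"
  shows "\<exists>T\<in>cyclics {3} H. card T = 3 \<and> normalizer_in H T = H"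
proof -
  let ?I = "{x \<in> H. ord x = 2}"
  note HG = subgroup.mem_carrier[OF H]
  have c: "a \<in> carrier G" "b \<in> carrier G" using ab HG by auto
  have sq: "x \<otimes> x = \<one>" if "x \<in> ?I" for x
    using that pow_ord_eq_1[of x] HG by (auto simp: numeral_2_eq_2)
  have aa: "a \<otimes> a = \<one>" "b \<otimes> b = \<one>" using sq ab by auto
  have inv: "inv a = a" "inv b = b" using aa c by (simp_all add: inv_equality)
  have cancel: "a \<otimes> (a \<otimes> z) = z" "b \<otimes> (b \<otimes> z) = z" if "z \<in> carrier G" for z
    using that c aa by (simp_all add: m_assoc[symmetric])
  have conjI: "conj_by h x \<in> ?I" if "h \<in> H" "x \<in> ?I" for h x
    using that conj_by_image_subset[OF H that(1), of "{x}"] ord_conj_by HG by simp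
  have ne: "a \<noteq> b" using ab(5) by auto
  define d where "d = conj_by a b"
  have dI: "d \<in> ?I" using conjI[of a b] ab d_def by simp
  have da: "d = a \<otimes> (b \<otimes> a)" using c inv by (simp add: d_def conj_by_def m_assoc)
  have d1: "d \<noteq> a"
  proof
    assume "d = a"
    then have "conj_by a b = conj_by a a" using c d_def aa by (simp add: conj_by_def inv)
    then show False using inj_on_conj_by[OF c(1)] c ne by (auto simp: inj_on_def)
  qed
  have d2: "d \<noteq> b" using ab(5) c by (simp add: d_def conj_by_eq_iff)
  have Ieq: "?I = {a, b, d}"
  proof -
    have "{a, b, d} \<subseteq> ?I" using ab dI by auto
    moreover have "card {a, b, d} = 3" using ne d1 d2 by simp
    ultimately show ?thesis using I finite_subgroup[OF H] card_subset_eq[of ?I "{a, b, d}"] by simp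
  qed
  have "conj_by b a \<in> ?I" using conjI[of b a] ab by simp
  moreover have "conj_by b a \<noteq> a" using ab(5) c by (auto simp: conj_by_eq_iff)
  moreover have "conj_by b a \<noteq> b"
  proof
    assume "conj_by b a = b"
    then have "conj_by b a = conj_by b b" using c aa by (simp add: conj_by_def inv)
    then show False using inj_on_conj_by[OF c(2)] c ne by (auto simp: inj_on_def)
  qed
  \<comment> \<open>Only one involution besides a and b is left, so aba = bab. This relation is what
    gives (ab)^3 = 1.\<close>
  ultimately have "conj_by b a = d" using Ieq by blast
  then have db: "d = b \<otimes> (a \<otimes> b)" using c inv by (simp add: conj_by_def m_assoc)
  have dc: "d \<in> carrier G" using dI HG by auto
  define t where "t = a \<otimes> b"
  have tH: "t \<in> H" "t \<in> carrier G" using ab c subgroup.m_closed[OF H] by (auto simp: t_def)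
  have t1: "t \<noteq> \<one>"
  proof
    assume "t = \<one>"
    then have "a = b" using c inv inv_equality[of a b] by (simp add: t_def)
    then show False using ne by simp
  qed
  have "t [^] (3::nat) = t \<otimes> t \<otimes> t" using tH by (simp add: numeral_3_eq_3)
  also have "\<dots> = (a \<otimes> (b \<otimes> a)) \<otimes> (b \<otimes> (a \<otimes> b))" using c by (simp add: t_def m_assoc)
  also have "\<dots> = d \<otimes> d" using da db by simp
  finally have "t [^] (3::nat) = \<one>" using sq[OF dI] by simp
  then have "ord t dvd 3" using tH by (simp add: pow_eq_id)
  moreover have "prime (3::nat)" by simp
  ultimately have ord_t: "ord t = 3" using t1 ord_eq_1[OF tH(2)] unfolding prime_nat_iff by blast
  let ?T = "generate G {t}"
  have Tsub: "subgroup ?T G" using generate_single_subgroup[OF tH(2)] .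
  have Tc: "card ?T = 3" using generate_pow_card[OF tH(2)] ord_t by simp
  have tT: "a \<otimes> b \<in> ?T" using generate_self[of t] t_def by simp
  have "inv t \<in> ?T" using subgroup.m_inv_closed[OF Tsub generate_self] .
  then have bT: "b \<otimes> a \<in> ?T" using c inv by (simp add: t_def inv_mult_group)
  \<comment> \<open>Each of these six products equals ab or its inverse ba.\<close>
  have prod: "x \<otimes> y \<in> ?T" if "x \<in> ?I" "y \<in> ?I" "x \<noteq> y" for x y
  proof -
    have "a \<otimes> d = b \<otimes> a" "b \<otimes> d = a \<otimes> b" using c cancel by (simp add: da, simp add: db)
    moreover have "d \<otimes> a = a \<otimes> b" "d \<otimes> b = b \<otimes> a" using c aa by (simp add: da m_assoc, simp add: db m_assoc)
    ultimately show ?thesis using that Ieq tT bT by auto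
  qed
  have T_normal: "normalizer_in H ?T = H"
  proof -
    have "conj_by h ` ?T = ?T" if h: "h \<in> H" for h
    proof -
      have "conj_by h t = conj_by h a \<otimes> conj_by h b" using h HG c by (simp add: t_def conj_by_distrib)
      moreover have "conj_by h a \<noteq> conj_by h b" using inj_on_conj_by[OF HG[OF h]] c ne by (auto simp: inj_on_def)
      ultimately have "conj_by h t \<in> ?T" using prod conjI[OF h] ab by simp
      then have "conj_by h ` ?T \<subseteq> ?T"
        using conj_by_generate[OF HG[OF h] tH(2)] generate_single_subset[OF Tsub] by simp
      then show ?thesis
        using card_conj_by[OF HG[OF h] subgroup.subset[OF Tsub]] finite_subgroup[OF Tsub] by (intro card_subset_eq)
    qed
    then show ?thesis by (auto simp: normalizer_in_def)
  qed
  have "?T \<in> cyclics {3} H" using cyclicsI[OF tH(1)] ord_t by (simp add: prime_prime_factors)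
  then show ?thesis using Tc T_normal by blast
qed

text \<open>The involutions and the identity form a Klein four-group stable under conjugation by
  \<open>H\<close>. It acts on the class of T, and every stabilizer is trivial, so the class splits
  into orbits of length 4.\<close>

lemma three_commuting_involutions:
  assumes H: "subgroup H G" and I: "card {x \<in> H. ord x = 2} = 3"
    and com: "\<And>a b. a \<in> H \<Longrightarrow> ord a = 2 \<Longrightarrow> b \<in> H \<Longrightarrow> ord b = 2 \<Longrightarrow> a \<otimes> b = b \<otimes> a"
    and free: "\<And>v y. v \<in> H \<Longrightarrow> ord v = 2 \<Longrightarrow> y \<in> H \<Longrightarrow> ord y = 3 \<Longrightarrow> y \<otimes> v \<noteq> v \<otimes> y"
    and T: "T \<in> cyclics {3} H" "card T = 3"
  shows "4 dvd card (conj_class H T)"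
proof -
  let ?I = "{x \<in> H. ord x = 2}"
  let ?K = "insert \<one> ?I"
  note HG = subgroup.mem_carrier[OF H]
  have TG: "T \<subseteq> carrier G" using cyclics_carrier[OF H T(1)] .
  have sq: "x \<otimes> x = \<one>" if "x \<in> ?I" for x
    using that pow_ord_eq_1[of x] HG by (auto simp: numeral_2_eq_2)
  have K: "subgroup ?K G"
  proof (rule subgroupI)
    show "?K \<subseteq> carrier G" using HG by auto
    show "?K \<noteq> {}" by simp
    show "inv x \<in> ?K" if "x \<in> ?K" for x
      using that HG subgroup.m_inv_closed[OF H] by auto
    show "x \<otimes> y \<in> ?K" if "x \<in> ?K" "y \<in> ?K" for x y
    proof (cases "x = \<one> \<or> y = \<one> \<or> x = y")
      case True then show ?thesis using that sq HG by auto
    next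
      case False
      then have xy: "x \<in> ?I" "y \<in> ?I" "x \<noteq> y" using that by auto
      then have c: "x \<in> carrier G" "y \<in> carrier G" "x \<otimes> y = y \<otimes> x" using HG com by auto
      have "(x \<otimes> y) [^] (2::nat) = \<one>" using pow_mult_distrib[OF c(3,1,2), of 2] sq[OF xy(1)] sq[OF xy(2)] c
        by (simp add: numeral_2_eq_2)
      then have "ord (x \<otimes> y) dvd 2" using c by (simp add: pow_eq_id)
      moreover have "x \<otimes> y \<noteq> \<one>"
      proof
        assume "x \<otimes> y = \<one>"
        then have "x \<otimes> y = y \<otimes> y" using sq[OF xy(2)] by simp
        then show False using c xy(3) by simp
      qed
      ultimately have "ord (x \<otimes> y) = 2" using ord_eq_1[of "x \<otimes> y"] c(1,2) two_is_prime_nat unfolding prime_nat_iff by blast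
      then show ?thesis using xy subgroup.m_closed[OF H] by auto
    qed
  qed
  have KH: "?K \<subseteq> H" using subgroup.one_closed[OF H] by auto
  have "\<one> \<notin> ?I" by auto
  then have cK: "card ?K = 4" using I finite_subgroup[OF H] by simp
  have free4: "card (conj_class ?K X) = 4" if X: "X \<in> conj_class H T" for X
  proof -
    have Xc: "card X = 3" using card_conj_class_member[OF H TG X] T(2) by simp
    have Xcs: "X \<in> cyclics {3} H" using conj_class_in_cyclics[OF H T(1) X] .
    have Xs: "subgroup X G" "X \<subseteq> H" "X \<subseteq> carrier G" using cyclics_subgroup[OF H Xcs] cyclics_subset[OF H Xcs] cyclics_carrier[OF H Xcs] by auto
    obtain x where x: "x \<in> H" "X = generate G {x}" using Xcs by (auto elim: cyclicsE)
    have xc: "x \<in> carrier G" and xX: "x \<in> X" using HG x generate_self[of x] by auto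
    have ox: "ord x = 3" using generate_pow_card[OF xc] x Xc by simp
    have "v = \<one>" if v: "v \<in> normalizer_in ?K X" for v
    proof (rule ccontr)
      assume "v \<noteq> \<one>"
      then have vI: "v \<in> ?I" and vX: "conj_by v ` X = X" using v by (auto simp: normalizer_in_def)
      then have vc: "v \<in> carrier G" using HG by auto
      \<comment> \<open>The commutator of v and x lies in X, which v normalizes, and in the Klein
        group, which x normalizes. Orders 3 and 4 force it to be trivial, so v and x commute,
        against \<open>free\<close>.\<close>
      let ?z = "conj_by v x \<otimes> inv x"
      have "conj_by v x \<in> X" using vX xX by blast
      then have z1: "?z \<in> X" using subgroup.m_closed[OF Xs(1)] subgroup.m_inv_closed[OF Xs(1) xX] by simp
      have "conj_by x (inv v) \<in> ?I"
        using conj_by_image_subset[OF H x(1), of "{inv v}"] vI subgroup.m_inv_closed[OF H] ord_conj_by[OF xc, of "inv v"] vc by simp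
      moreover have "?z = v \<otimes> conj_by x (inv v)" using vc xc by (simp add: conj_by_def m_assoc)
      ultimately have z2: "?z \<in> ?K" using subgroup.m_closed[OF K] vI by simp
      have zc: "?z \<in> carrier G" using vc xc by simp
      have "ord ?z dvd 3" "ord ?z dvd 4" using ord_dvd_card[OF Xs(1) z1] ord_dvd_card[OF K z2] Xc cK by simp_all
      then have "ord ?z dvd 4 - 3" by (rule dvd_diff_nat[rotated])
      then have "?z = \<one>" using ord_eq_1[OF zc] by simp
      then have "conj_by v x = x" using vc xc by (metis conj_by_closed inv_closed inv_equality inv_inv)
      then have "x \<otimes> v = v \<otimes> x" using vc xc by (simp add: conj_by_eq_iff)
      then show False using free[of v x] vI x(1) ox by auto
    qed
    then have "normalizer_in ?K X = {\<one>}" using subgroup.one_closed[OF normalizer_in_subgroup[OF K Xs(3)]] by blast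
    then show ?thesis using orbit_stabilizer[OF K Xs(3)] cK by simp
  qed
  have XG: "X \<subseteq> carrier G" if "X \<in> conj_class H T" for X using that conj_class_in_cyclics[OF H T(1)] cyclics_carrier[OF H] by blast
  have "\<Union>(conj_class ?K ` conj_class H T) = conj_class H T"
  proof (intro subset_antisym subsetI)
    fix Y assume "Y \<in> \<Union>(conj_class ?K ` conj_class H T)"
    then obtain X where X: "X \<in> conj_class H T" "Y \<in> conj_class ?K X" by blast
    then have "Y \<in> conj_class H X" using KH by (auto simp: conj_class_def)
    then show "Y \<in> conj_class H T" using conj_class_eq[OF H TG X(1)] by simp
  next
    fix Y assume "Y \<in> conj_class H T"
    then show "Y \<in> \<Union>(conj_class ?K ` conj_class H T)" using conj_class_refl[OF K XG] by blast
  qed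
  moreover have "4 dvd card (\<Union>(conj_class ?K ` conj_class H T))"
  proof (rule dvd_partition)
    show "finite (\<Union>(conj_class ?K ` conj_class H T))" using calculation finite_conj_class[OF H] by simp
    show "\<forall>c\<in>conj_class ?K ` conj_class H T. 4 dvd card c" using free4 by auto
    show "\<forall>c1\<in>conj_class ?K ` conj_class H T. \<forall>c2\<in>conj_class ?K ` conj_class H T. c1 \<noteq> c2 \<longrightarrow> c1 \<inter> c2 = {}"
      using conj_class_disjoint[OF K XG XG] conj_class_eq[OF K XG] by blast
  qed
  ultimately show ?thesis by simp
qed

text \<open>With e and e' the values at \<open>H\<close> and at the centralizer, the recursion at
  the prime 3 reads 2 e = e' + (sum over nontrivial cyclic 3-subgroups). The sum is e' if the
  involutions do not commute, since then one normal subgroup of order 3 is the only summand;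
  otherwise one class already weighs at least 4.\<close>

lemma three_involutions:
  assumes H: "subgroup H G" and \<sigma>: "primes_above 2 \<sigma>" and U: "U \<in> cyclics {2} H - {{\<one>}}"
    and S: "cyclics {2} H - {{\<one>}} = conj_class H U" and c: "card U = 2" "card (conj_class H U) = 3"
    and M: "missing \<sigma> H U = {3}"
  shows "eta_part \<sigma> H = eta_part \<sigma> (centralizer_in H U) \<or> eta_part \<sigma> H \<ge> (eta_part \<sigma> (centralizer_in H U) + 4) / 2"
proof -
  have Uc: "U \<in> cyclics {2} H" and UG: "U \<subseteq> carrier G" using U cyclics_carrier[OF H] by auto
  note HG = subgroup.mem_carrier[OF H]
  let ?C = "centralizer_in H U" and ?I = "{x \<in> H. ord x = 2}"
  note C = centralizer_in_subgroup[OF H UG]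
  have three: "3 \<in> \<sigma>" "3 dvd card H" "\<not> 3 dvd card ?C" using M by (auto simp: missing_def)
  \<comment> \<open>3 is the smallest prime of \<open>\<sigma>\<close>, so the recursion can be
    unfolded once at 3 with \<open>\<tau>\<close> as the set of larger primes.\<close>
  define \<tau> where "\<tau> = \<sigma> - {3}"
  have \<sigma>\<tau>: "\<sigma> = insert 3 \<tau>" using three by (auto simp: \<tau>_def)
  have \<tau>: "primes_above 3 \<tau>" 
    unfolding primes_above_def
  proof (intro conjI ballI)
    show "finite \<tau>" using \<sigma> by (simp add: primes_above_def \<tau>_def)
    fix q assume "q \<in> \<tau>"
    then have "prime q" "2 < q" "q \<noteq> 3" using \<sigma> by (auto simp: primes_above_def \<tau>_def)
    then show "prime q" "3 < q" by simp_all
  qed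
  have fin: "finite \<tau>" "finite \<sigma>" using \<sigma> by (auto simp: primes_above_def \<tau>_def)
  have eC: "eta_part \<sigma> ?C = eta_part \<tau> ?C" unfolding \<sigma>\<tau> using eta_part_not_dvd[OF C three(3)] .
  \<comment> \<open>The orbit of U under the powers of x has at most three members and a size
    dividing \<open>ord x\<close>, whose primes exceed 3. So x normalizes U and then centralizes
    it.\<close>
  have tau_centralizes: "x \<in> ?C" if x: "x \<in> H" "prime_factors (ord x) \<subseteq> \<tau>" for x
  proof -
    have xc: "x \<in> carrier G" using HG x by simp
    let ?K = "generate G {x}"
    have K: "subgroup ?K G" "?K \<subseteq> H" using generate_single_subgroup[OF xc] generate_single_subset[OF H x(1)] by auto
    have "card (conj_class ?K U) dvd ord x" using orbit_stabilizer[OF K(1) UG] generate_pow_card[OF xc] by simp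
    moreover have "card (conj_class ?K U) \<le> 3"
      using card_mono[OF finite_conj_class[OF H], of "conj_class ?K U" U] K(2) c(2) by (auto simp: conj_class_def)
    ultimately have "card (conj_class ?K U) = 1"
    proof -
      assume d: "card (conj_class ?K U) dvd ord x" "card (conj_class ?K U) \<le> 3"
      show ?thesis
      proof (rule ccontr)
        assume "card (conj_class ?K U) \<noteq> 1"
        then obtain q where q: "prime q" "q dvd card (conj_class ?K U)" using prime_factor_nat by blast
        then have "q dvd ord x" using d(1) dvd_trans by blast
        then have "q \<in> \<tau>" using q(1) x(2) ord_pos[OF xc] by (auto simp: in_prime_factors_iff)
        then have "q > 3" using \<tau> by (auto simp: primes_above_def)
        moreover have "q \<le> 3" using dvd_imp_le[OF q(2) card_conj_class_pos[OF K(1) UG]] d(2) by simp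
        ultimately show False by simp
      qed
    qed
    then have "x \<in> normalizer_in ?K U" using card_conj_class_eq_1[OF K(1) UG] generate_self[of x] by simp
    then have "x \<in> normalizer_in H U" using x(1) by (auto simp: normalizer_in_def)
    moreover have "\<forall>q\<in>prime_factors (ord x). 2 < q" using x(2) \<tau> by (fastforce simp: primes_above_def)
    ultimately show ?thesis using normalizer_in_imp_centralizer_in[OF H two_is_prime_nat Uc] by blast
  qed
  have "cyclics \<tau> H = cyclics \<tau> ?C" using tau_centralizes centralizer_in_subset[of H U] unfolding cyclics_def by blast
  moreover have "missing \<tau> H U = {}" using M by (auto simp: missing_def \<tau>_def)
  ultimately have eH: "eta_part \<tau> H = eta_part \<sigma> ?C"
    using num_primes_split[OF H UG fin(1)] eC by (simp add: eta_part_def)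
  have p3: "prime (3::nat)" by simp
  have rec: "2 * eta_part \<sigma> H = eta_part \<sigma> ?C + (\<Sum>V\<in>cyclics {3} H - {{\<one>}}. share \<tau> H V)"
    unfolding \<sigma>\<tau> using eta_part_rec[OF H p3 three(2) \<tau>] eH \<sigma>\<tau> by simp
  have cI: "card ?I = 3" using bij_betw_same_card[OF involutions_bij[OF H U S c(1)]] c(2) by simp
  show ?thesis
  proof (cases "\<exists>a\<in>?I. \<exists>b\<in>?I. a \<otimes> b \<noteq> b \<otimes> a")
    case True
    then obtain T where T: "T \<in> cyclics {3} H" "card T = 3" "normalizer_in H T = H"
      using three_noncommuting_involutions[OF H cI] by blast
    have TG: "T \<subseteq> carrier G" and Ts: "subgroup T G" and TH: "T \<subseteq> H"
      using cyclics_carrier[OF H T(1)] cyclics_subgroup[OF H T(1)] cyclics_subset[OF H T(1)] by auto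
    have n3: "\<not> 3 dvd card (normalizer_in H U)"
    proof
      assume "3 dvd card (normalizer_in H U)"
      then obtain y where y: "y \<in> normalizer_in H U" "ord y = 3" using cauchy[OF normalizer_in_subgroup[OF H UG] p3] by blast
      then have "y \<in> ?C" using normalizer_in_imp_centralizer_in[OF H two_is_prime_nat Uc y(1)] by (simp add: prime_prime_factors)
      then show False using ord_dvd_card[OF C] y(2) three(3) by metis
    qed
    \<comment> \<open>T and the class of U both have three elements, so the order of the normalizer
      of U is the index of T. It is prime to 3, which puts all elements of 3-power order into
      T.\<close>
    have cH: "card H = card (normalizer_in H U) * card T" using orbit_stabilizer[OF H UG] c(2) T(2) by simp
    have "cyclics {3} H - {{\<one>}} = {T}"
    proof (intro subset_antisym subsetI)
      fix V assume V: "V \<in> cyclics {3} H - {{\<one>}}"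
      then obtain x where x: "x \<in> H" "V = generate G {x}" "prime_factors (ord x) \<subseteq> {3}" by (auto elim: cyclicsE)
      have xc: "x \<in> carrier G" using HG x by simp
      let ?n = "card (normalizer_in H U)"
      have "prime_factors ?n \<inter> {3} = {}" using n3 by auto
      then have cop: "coprime ?n (ord x)"
        using coprime_of_prime_factors[of ?n "ord x", OF _ ord_pos[OF xc] order_refl x(3)]
          card_subgroup_pos[OF normalizer_in_subgroup[OF H UG]] by simp
      obtain k where k: "[?n * k = 1] (mod ord x)" using cong_solve_coprime_nat[OF cop] by auto
      have "x [^] (?n * k) = x" using pow_eq_cong[OF xc k] xc by simp
      moreover have xn: "x [^] ?n \<in> T" using pow_index_mem[OF H Ts TH T(3) cH x(1)] .
      moreover have "(x [^] ?n) [^] k \<in> T"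
        using pow_mem_generate[of "x [^] ?n" k] generate_single_subset[OF Ts xn] xc by auto
      ultimately have "x \<in> T" using xc by (simp add: nat_pow_pow)
      moreover have "x \<noteq> \<one>" using V x(2) generate_one by auto
      ultimately show "V \<in> {T}" using order_p_generate(1)[OF p3 Ts T(2)] x(2) by simp
    next
      fix V assume "V \<in> {T}"
      then show "V \<in> cyclics {3} H - {{\<one>}}" using T by auto
    qed
    moreover have "conj_class H T = {T}" using conj_class_of_normalizer_in[OF H TG T(3)] .
    moreover have "weight \<tau> H T = eta_part \<tau> H"
      using weight_normal[OF H p3 T(1) \<tau>] card_conj_class_eq_1[OF H TG] T(3) by simp
    ultimately have "2 * eta_part \<sigma> H = eta_part \<sigma> ?C + eta_part \<sigma> ?C"
      using rec sum_share_conj_class[OF H TG fin(1)] eH by simp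
    then show ?thesis by simp
  next
    case False
    obtain T where T: "T \<in> cyclics {3} H - {{\<one>}}" "card T = 3" using exists_order_p[OF H p3 three(2)] by blast
    have TG: "T \<subseteq> carrier G" using cyclics_carrier[OF H] T(1) by blast
    have free: "y \<otimes> v \<noteq> v \<otimes> y" if vy: "v \<in> H" "ord v = 2" "y \<in> H" "ord y = 3" for v y
    proof
      assume "y \<otimes> v = v \<otimes> y"
      then have y: "y \<in> centralizer_in H (generate G {v})" using generate_centralizer_in[OF H HG[OF vy(1)]] vy(3) by simp
      have "generate G {v} \<in> conj_class H U"
        using involutions_bij[OF H U S c(1)] vy unfolding bij_betw_def by blast
      then have "card (centralizer_in H (generate G {v})) = card ?C" using card_centralizer_in_conj_class[OF H UG] by blast
      moreover have "generate G {v} \<subseteq> carrier G" using generate_single_subgroup[OF HG[OF vy(1)]] subgroup.subset by blast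
      ultimately show False using ord_dvd_card[OF centralizer_in_subgroup[OF H] y] vy(4) three(3) by simp
    qed
    have "4 dvd card (conj_class H T)"
      using three_commuting_involutions[OF H cI _ free _ T(2)] False T(1) by blast
    then obtain m where m: "card (conj_class H T) = 4 * m" by (auto elim: dvdE)
    have m0: "m > 0" using m card_conj_class_pos[OF H TG] by simp
    have "T \<in> cyclics {3} H" using T by simp
    \<comment> \<open>The missing primes exceed 3, so they divide the cofactor m of the class size 4
      m. The denominators are paid by m alone and the factor 4 survives.\<close>
    have "(real 2 / 2) ^ card (missing \<tau> H T) \<le> real m / 2 ^ card (missing \<tau> H T)"
    proof (rule primes_prod_ratio_ge[OF missing_finite[OF fin(1)] _ _ m0])
      fix q assume q: "q \<in> missing \<tau> H T"
      then show pq: "prime q" "2 \<le> q" using \<tau> by (auto simp: missing_def primes_above_def)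
      have "3 < q" using q \<tau> by (auto simp: missing_def primes_above_def)
      have "q dvd 2 * (2 * m)" using missing_dvd_conj_class[OF H p3 \<open>T \<in> cyclics {3} H\<close> \<tau> q] m by simp
      moreover have "\<not> q dvd 2" using \<open>3 < q\<close> by (auto dest: dvd_imp_le)
      ultimately show "q dvd m" using pq(1) prime_dvd_mult_iff by blast
    qed
    then have "1 \<le> real m / 2 ^ card (missing \<tau> H T)" by (simp only: of_nat_numeral div_self) simp
    moreover have "real (card (conj_class H T)) / 2 ^ card (missing \<tau> H T) = 4 * (real m / 2 ^ card (missing \<tau> H T))"
      using m by simp
    ultimately have "4 \<le> real (card (conj_class H T)) / 2 ^ card (missing \<tau> H T)" by linarith
    also have "\<dots> \<le> weight \<tau> H T" using weight_ge_ratio[OF H TG \<tau>] .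
    also have "\<dots> = (\<Sum>V\<in>conj_class H T. share \<tau> H V)" using sum_share_conj_class[OF H TG fin(1)] by simp
    also have "\<dots> \<le> (\<Sum>V\<in>cyclics {3} H - {{\<one>}}. share \<tau> H V)"
      using conj_class_subset_nontriv[OF H T(1)] finite_cyclics[OF H] share_nonneg by (intro sum_mono2) auto
    finally show ?thesis using rec by simp
  qed
qed


text \<open>A crude bound that is good enough: with two missing primes, 12 / 2^2 is the weight 3
  needed later.\<close>

lemma two_distinct_odd_primes_le:
  fixes a b m :: nat
  assumes "prime a" "prime b" "2 < a" "2 < b" "a \<noteq> b" "a dvd m" "b dvd m" "m > 0" shows "12 \<le> m"
proof -
  have "a * b dvd m" using assms by (intro divides_mult primes_coprime)
  then have "a * b \<le> m" using assms(8) dvd_imp_le by blast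
  moreover have "3 * 4 \<le> a * b \<or> 4 * 3 \<le> a * b"
    using assms(3-5) mult_le_mono[of 3 a 4 b] mult_le_mono[of 4 a 3 b] by linarith
  ultimately show ?thesis by simp
qed

section \<open>The possible values after adding the prime 2\<close>

text \<open>A case is settled once the right side of the recursion reaches 4. What stays below: one
  normal class (value unchanged), two normal classes (3/2), a normal class beside one of weight 3/2
  (7/4), three conjugate involutions (5/4 or 15/8), five conjugate involutions (7/4).\<close>

lemma eta_part_values:
  assumes \<sigma>: "primes_above 2 \<sigma>" and H: "subgroup H G"
  shows "eta_part (insert 2 \<sigma>) H \<in> {1, 5/4, 3/2, 7/4, 15/8} \<or> eta_part (insert 2 \<sigma>) H \<ge> 2"
proof (cases "2 dvd card H")
  case False
  then show ?thesis using eta_part_not_dvd[OF H False] eta_part_odd[OF _ _ H, of \<sigma>] \<sigma> by (auto simp: primes_above_def)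
next
  case True
  have fin: "finite \<sigma>" using \<sigma> by (simp add: primes_above_def)
  have odd: "eta_part \<sigma> K = 1 \<or> eta_part \<sigma> K = 3/2 \<or> eta_part \<sigma> K \<ge> 2" if "subgroup K G" for K
    using eta_part_odd[OF _ _ that, of \<sigma>] \<sigma> by (auto simp: primes_above_def)
  note p = two_is_prime_nat
  have b: "3 \<le> q" if "q \<in> \<sigma>" for q using that \<sigma> by (auto simp: primes_above_def Suc_le_eq numeral_3_eq_3 numeral_2_eq_2)
  let ?S = "cyclics {2} H - {{\<one>}}" and ?E = "eta_part (insert 2 \<sigma>) H"
  define T where "T = (\<Sum>U\<in>?S. share \<sigma> H U)"
  have rec: "2 * ?E = eta_part \<sigma> H + T" using eta_part_rec[OF H p True \<sigma>] T_def by simp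
  note r = odd[OF H]
  have w1: "weight \<sigma> H V \<ge> 1" if "V \<in> ?S" for V using weight_ge_1[OF H p _ \<sigma>] that by auto
  have wU: "weight \<sigma> H V = eta_part \<sigma> H" if "V \<in> ?S" "card (conj_class H V) = 1" for V
    using weight_normal[OF H p _ \<sigma> that(2)] that(1) by auto
  have w2: "weight \<sigma> H V \<ge> 3/2" if "V \<in> ?S" "card (conj_class H V) \<noteq> 1" for V
    using weight_ge_not_normal[OF H p _ \<sigma> that(2) b] that(1) by auto
  show ?thesis
  proof (cases "\<exists>U\<in>?S. card (conj_class H U) = 1")
    case True
    then obtain U where U: "U \<in> ?S" "card (conj_class H U) = 1" by blast
    show ?thesis
    proof (cases rule: orbit_cases[OF H U(1) fin])
      case 1 then show ?thesis using rec wU[OF U] r T_def by auto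
    next
      case (2 V)
      then have V: "V \<in> ?S" "T = eta_part \<sigma> H + weight \<sigma> H V" using wU[OF U] T_def by auto
      then have Vc: "V \<in> cyclics {2} H" and VG: "V \<subseteq> carrier G" using cyclics_carrier[OF H] by auto
      let ?m = "card (conj_class H V)"
      have wm: "real ?m / 2 ^ card (missing \<sigma> H V) \<le> weight \<sigma> H V" using weight_ge_ratio[OF H VG \<sigma>] .
      consider "eta_part \<sigma> H = 1" "?m = 1" | "eta_part \<sigma> H = 1" "?m \<noteq> 1" | "eta_part \<sigma> H \<ge> 3/2" using r by linarith
      then show ?thesis
      proof cases
        case 1 then show ?thesis using rec V wU[OF V(1)] by auto
      next
        case 2
        have m2: "?m \<ge> 2" using 2(2) card_conj_class_pos[OF H VG] by linarith
        have "weight \<sigma> H V = 3/2 \<or> weight \<sigma> H V \<ge> 2"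
        proof (cases rule: missing_cases[OF H p Vc \<sigma>])
          case 1 then show ?thesis using wm m2 by simp
        next
          case (2 q)
          show ?thesis
          proof (cases "?m \<ge> 4")
            case True then show ?thesis using wm 2(1) by simp
          next
            case False
            \<comment> \<open>Size 2 is impossible because the odd q divides the size. With size 3
              the gap in the odd values makes the weight 3/2 or at least 9/4.\<close>
            then have "?m = 3" using dvd_imp_le[OF 2(3)] b[OF 2(2)] m2 by linarith
            then have "weight \<sigma> H V = 3 / 2 * eta_part \<sigma> (centralizer_in H V)" using 2(1) by (simp add: weight_def)
            then show ?thesis using odd[OF centralizer_in_subgroup[OF H VG]] by auto
          qed
        next
          case 3
          then have "(real 3 / 2) ^ 2 \<le> (real 3 / 2) ^ card (missing \<sigma> H V)" by (intro power_increasing) auto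
          then show ?thesis using weight_ge[OF H p Vc \<sigma> b] by (simp add: power2_eq_square)
        qed
        then show ?thesis using rec V 2(1) by auto
      next
        case 3 then show ?thesis using rec V w1[OF V(1)] by auto
      qed
    next
      case (3 V W)
      then show ?thesis using rec w1[of V] w1[of W] wU[OF U] r T_def by auto
    qed
  next
    case False
    then have w: "weight \<sigma> H V \<ge> 3/2" if "V \<in> ?S" for V using w2 that by auto
    obtain U where U: "U \<in> ?S" using exists_order_p[OF H p True] by blast
    then have Uc: "U \<in> cyclics {2} H" and UG: "U \<subseteq> carrier G" using cyclics_carrier[OF H] by auto
    let ?m = "card (conj_class H U)" and ?e = "eta_part \<sigma> (centralizer_in H U)"
    have wm: "real ?m / 2 ^ card (missing \<sigma> H U) \<le> weight \<sigma> H U" using weight_ge_ratio[OF H UG \<sigma>] .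
    show ?thesis
    proof (cases rule: orbit_cases[OF H U fin])
      case 1
      then have ET: "2 * ?E = eta_part \<sigma> H + weight \<sigma> H U" using rec T_def by simp
      have cU: "card U = 2" and "2 dvd ?m - 1" using single_orbit[OF H p True U 1(1)] by auto
      moreover have "?m \<noteq> 1" "?m > 0" using False U card_conj_class_pos[OF H UG] by auto
      ultimately have m: "?m \<ge> 3" "odd ?m" by presburger+
      show ?thesis
      proof (cases rule: missing_cases[OF H p Uc \<sigma>])
        case 1 then show ?thesis using ET r wm m(1) by auto
      next
        case (2 q)
        have wq: "weight \<sigma> H U = real ?m / 2 * ?e" using 2(1) by (simp add: weight_def)
        have e: "?e = 1 \<or> ?e = 3/2 \<or> ?e \<ge> 2" using odd[OF centralizer_in_subgroup[OF H UG]] .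
        have "?m \<noteq> 4" using m(2) by auto
        \<comment> \<open>The number of involutions is odd, so 4 drops out; from 6 on the weight is
          at least 3.\<close>
        then consider "?m = 3" | "?m = 5" | "?m \<ge> 6" using m(1) by linarith
        then show ?thesis
        proof cases
          case m3: 1
          have "q = 3" using dvd_imp_le[OF 2(3)] b[OF 2(2)] m3 by linarith
          then have "eta_part \<sigma> H = ?e \<or> eta_part \<sigma> H \<ge> (?e + 4) / 2"
            using three_involutions[OF H \<sigma> U 1(1) cU m3] 2(1) by simp
          \<comment> \<open>For e = e' the right side is 5/2 e, that is 5/2, 15/4 or at least 5.
            Otherwise e is at least 5/2 and the weight at least 3/2, which make 4.\<close>
          then show ?thesis using ET wq m3 e r by auto
        next
          case m5: 2
          \<comment> \<open>Only e = e' = 1 stays below 4, with 1 + 5/2 = 7/2.\<close>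
          then show ?thesis using ET wq e r by auto
        next
          case 3
          then show ?thesis using ET wm 2(1) r by auto
        qed
      next
        case 3
        have "weight \<sigma> H U \<ge> 3"
        \<comment> \<open>The general bound (3/2)^k exceeds 3 only from k = 3 on. For k = 2 it gives
          9/4, and the distinctness of the two primes has to be used.\<close>
        proof (cases "card (missing \<sigma> H U) = 2")
          case True
          then obtain a c where ac: "missing \<sigma> H U = {a, c}" "a \<noteq> c" by (auto simp: card_2_iff)
          then have "prime a" "prime c" "2 < a" "2 < c" using \<sigma> by (auto simp: missing_def primes_above_def)
          then have "12 \<le> ?m" using two_distinct_odd_primes_le[OF _ _ _ _ ac(2)] missing_dvd_conj_class[OF H p Uc \<sigma>] ac(1)
              card_conj_class_pos[OF H UG] by simp
          then show ?thesis using wm True by simp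
        next
          case False
          then have "(real 3 / 2) ^ 3 \<le> (real 3 / 2) ^ card (missing \<sigma> H U)" using 3 by (intro power_increasing) auto
          then show ?thesis using weight_ge[OF H p Uc \<sigma> b] by (simp add: power3_eq_cube)
        qed
        then show ?thesis using ET r by auto
      qed
    next
      case (2 V)
      then show ?thesis using rec r w[of U] w[of V] U T_def by auto
    next
      case (3 V W)
      then show ?thesis using rec r w[of U] w[of V] w[of W] U T_def by auto
    qed
  qed
qed

end

section \<open>The invariant and the examples\<close>

lemma (in group) cyclic_subgroups_eq: "cyclic_subgroups G = (\<lambda>x. generate G {x}) ` carrier G"
proof (intro subset_antisym subsetI)
  fix H assume "H \<in> cyclic_subgroups G"
  then have H: "subgroup H G" "cyclic_group (G\<lparr>carrier := H\<rparr>)" by (auto simp: cyclic_subgroups_def)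
  then obtain x where x: "x \<in> H" "H = range (\<lambda>n::int. x [^]\<^bsub>G\<lparr>carrier := H\<rparr>\<^esub> n)"
    using group.cyclic_group[OF subgroup_imp_group[OF H(1)]] by auto
  have xc: "x \<in> carrier G" using subgroup.mem_carrier[OF H(1) x(1)] .
  have "H = range (\<lambda>n::int. x [^] n)" using x(2) int_pow_consistent[OF H(1) x(1)] by simp
  also have "\<dots> = generate G {x}" using generate_pow[OF xc] by auto
  finally show "H \<in> (\<lambda>x. generate G {x}) ` carrier G" using xc by blast
next
  fix H assume "H \<in> (\<lambda>x. generate G {x}) ` carrier G"
  then obtain x where x: "x \<in> carrier G" "H = generate G {x}" by blast
  have H: "subgroup H G" using generate_single_subgroup[OF x(1)] x(2) by simp
  have xH: "x \<in> H" using generate_self x(2) by simp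
  have "H = range (\<lambda>n::int. x [^] n)" using generate_pow[OF x(1)] x(2) by auto
  then have "H = range (\<lambda>n::int. x [^]\<^bsub>G\<lparr>carrier := H\<rparr>\<^esub> n)" using int_pow_consistent[OF H xH] by simp
  then have "cyclic_group (G\<lparr>carrier := H\<rparr>)"
    using group.cyclic_group[OF subgroup_imp_group[OF H]] xH by auto
  then show "H \<in> cyclic_subgroups G" using H by (simp add: cyclic_subgroups_def)
qed

context finite_group
begin

lemma order_pos: "order G > 0"
  using finite_carrier by (simp add: order_gt_0_iff_finite)

lemma eta_eq_eta_part: "eta G = eta_part (prime_factors (order G)) (carrier G)"
proof -
  have "prime_factors (ord x) \<subseteq> prime_factors (order G)" if "x \<in> carrier G" for x
    using ord_dvd_group_order[OF that] order_pos by (intro dvd_prime_factors) auto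
  then have "cyclics (prime_factors (order G)) (carrier G) = cyclic_subgroups G"
    unfolding cyclics_def cyclic_subgroups_eq by blast
  moreover have "{q \<in> prime_factors (order G). q dvd card (carrier G)} = prime_factors (order G)"
    by (auto simp: order_def)
  ultimately show ?thesis by (simp add: eta_def eta_part_def cyc_def num_prime_divisors_def num_primes_def)
qed

lemma eta_values: "eta G \<in> {1, 5/4, 3/2, 7/4, 15/8} \<or> eta G \<ge> 2"
proof -
  let ?\<sigma> = "prime_factors (order G) - {2}"
  have \<sigma>: "primes_above 2 ?\<sigma>"
    unfolding primes_above_def
  proof (intro conjI ballI)
    fix q assume "q \<in> ?\<sigma>"
    then have "prime q" "q \<noteq> 2" by (auto simp: in_prime_factors_iff)
    then show "prime q" "2 < q" using prime_ge_2_nat[of q] by auto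
  qed simp
  \<comment> \<open>2 is inserted even when the group has odd order; it then changes neither the
    count nor the denominator.\<close>
  have "eta G = eta_part (insert 2 ?\<sigma>) (carrier G)"
  proof (cases "2 \<in> prime_factors (order G)")
    case True
    then show ?thesis by (simp add: eta_eq_eta_part insert_absorb)
  next
    case False
    then have "\<not> 2 dvd card (carrier G)" using order_pos by (auto simp: in_prime_factors_iff order_def)
    then show ?thesis using eta_part_not_dvd[OF subgroup_self] False by (simp add: eta_eq_eta_part)
  qed
  then show ?thesis using eta_part_values[OF \<sigma> subgroup_self] by simp
qed

end

section \<open>Transport along isomorphisms and coprime direct products\<close>

lemma finite_groupI: "group G \<Longrightarrow> finite (carrier G) \<Longrightarrow> finite_group G"
  by (simp add: finite_group_def finite_group_axioms_def)

lemma eta_iso: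
  assumes G: "group G" and K: "group K" and h: "h \<in> iso G K"
  shows "eta K = eta G"
proof -
  interpret G: group G by (rule G)
  interpret K: group K by (rule K)
  have bij: "bij_betw h (carrier G) (carrier K)" and hom: "h \<in> hom G K" using h by (auto simp: iso_def)
  interpret h: group_hom G K h using hom by unfold_locales
  have "cyclic_subgroups K = (\<lambda>x. generate K {h x}) ` carrier G"
    unfolding K.cyclic_subgroups_eq bij_betw_imp_surj_on[OF bij, symmetric] by (simp add: image_image)
  also have "\<dots> = (\<lambda>x. h ` generate G {x}) ` carrier G"
  proof (rule image_cong[OF refl])
    fix x assume "x \<in> carrier G"
    then show "generate K {h x} = h ` generate G {x}" using h.generate_img[of "{x}"] by simp
  qed
  also have "\<dots> = (\<lambda>H. h ` H) ` cyclic_subgroups G" using G.cyclic_subgroups_eq by auto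
  finally have "cyclic_subgroups K = (\<lambda>H. h ` H) ` cyclic_subgroups G" .
  moreover have "inj_on (\<lambda>H. h ` H) (cyclic_subgroups G)"
  proof (rule inj_on_subset)
    show "inj_on ((`) h) (Pow (carrier G))" using bij inj_on_image_Pow by (auto simp: bij_betw_def)
    show "cyclic_subgroups G \<subseteq> Pow (carrier G)" by (auto simp: cyclic_subgroups_def dest: subgroup.subset)
  qed
  ultimately have "cyc K = cyc G" by (simp add: cyc_def card_image)
  moreover have "order K = order G" using bij_betw_same_card[OF bij] by (simp add: order_def)
  ultimately show ?thesis by (simp add: eta_def num_prime_divisors_def)
qed

text \<open>The examples live on pairs and integers; an injection of a countable type into the
  naturals carries them over to the type \<open>nat\<close> without changing
  \<open>eta\<close>.\<close>

lemma exists_nat_group: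
  fixes G :: "('c::countable) monoid"
  assumes G: "group G" "finite (carrier G)"
  shows "\<exists>H :: nat monoid. group H \<and> finite (carrier H) \<and> eta H = eta G"
proof -
  let ?H = "image_group to_nat G"
  have inj: "inj_on to_nat (carrier G)" using inj_to_nat inj_on_subset by blast
  have "group ?H" using group.inj_imp_image_group_is_group[OF G(1) inj] .
  moreover have "eta ?H = eta G" using eta_iso[OF G(1) calculation inj_imp_image_group_iso[OF inj]] .
  moreover have "finite (carrier ?H)" using G(2) by (simp add: image_group_carrier)
  ultimately show ?thesis by blast
qed

text \<open>For coprime orders (x, y) has order \<open>ord x * ord y\<close>, so it generates the
  full product of the two cyclic groups. Hence \<open>cyc\<close> is multiplicative, while the sets
  of primes are disjoint and their sizes add.\<close>

lemma eta_DirProd: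
  assumes G: "group G" "finite (carrier G)" and K: "group K" "finite (carrier K)"
    and cop: "coprime (order G) (order K)"
  shows "eta (G \<times>\<times> K) = eta G * eta K"
proof -
  interpret G: finite_group G using finite_groupI[OF G] .
  interpret K: finite_group K using finite_groupI[OF K] .
  interpret P: finite_group "G \<times>\<times> K"
    by (rule finite_groupI[OF DirProd_group[OF G(1) K(1)]]) (simp add: G(2) K(2))
  have pow: "(x, y) [^]\<^bsub>G \<times>\<times> K\<^esub> n = (x [^]\<^bsub>G\<^esub> n, y [^]\<^bsub>K\<^esub> n)" for x y and n :: nat
    by (induction n) simp_all
  have gen: "generate (G \<times>\<times> K) {(x, y)} = generate G {x} \<times> generate K {y}"
    if x: "x \<in> carrier G" and y: "y \<in> carrier K" for x y
  proof (rule card_subset_eq)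
    have sub: "subgroup (generate G {x} \<times> generate K {y}) (G \<times>\<times> K)"
      using DirProd_subgroups[OF G(1) G.generate_single_subgroup[OF x] K(1) K.generate_single_subgroup[OF y]] .
    show "finite (generate G {x} \<times> generate K {y})" using P.finite_subgroup[OF sub] .
    show "generate (G \<times>\<times> K) {(x, y)} \<subseteq> generate G {x} \<times> generate K {y}"
      using P.generate_single_subset[OF sub] G.generate_self K.generate_self by simp
    have "coprime (G.ord x) (K.ord y)"
      using cop G.ord_dvd_group_order[OF x] K.ord_dvd_group_order[OF y] coprime_divisors by blast
    moreover have "(x, y) \<in> carrier (G \<times>\<times> K)" using x y by simp
    ultimately have "P.ord (x, y) = G.ord x * K.ord y"
      using P.ord_unique[of "(x, y)"] x y by (auto simp: pow G.pow_eq_id K.pow_eq_id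
          intro: divides_mult dvd_mult_left dvd_mult_right)
    then show "card (generate (G \<times>\<times> K) {(x, y)}) = card (generate G {x} \<times> generate K {y})"
      using P.generate_pow_card[of "(x, y)"] G.generate_pow_card[OF x] K.generate_pow_card[OF y] x y
      by (simp add: card_cartesian_product)
  qed
  have "cyclic_subgroups (G \<times>\<times> K) = (\<lambda>(x, y). generate G {x} \<times> generate K {y}) ` (carrier G \<times> carrier K)"
    unfolding P.cyclic_subgroups_eq carrier_DirProd by (rule image_cong[OF refl]) (auto simp: gen)
  also have "\<dots> = (\<lambda>(A, B). A \<times> B) ` (cyclic_subgroups G \<times> cyclic_subgroups K)"
    unfolding G.cyclic_subgroups_eq K.cyclic_subgroups_eq by force
  finally have *: "cyclic_subgroups (G \<times>\<times> K) = (\<lambda>(A, B). A \<times> B) ` (cyclic_subgroups G \<times> cyclic_subgroups K)" .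
  \<comment> \<open>A product set determines its factors only if both are nonempty.\<close>
  have neG: "A \<noteq> {}" if "A \<in> cyclic_subgroups G" for A
    using that by (auto simp: cyclic_subgroups_def dest: subgroup.one_closed)
  have neK: "A \<noteq> {}" if "A \<in> cyclic_subgroups K" for A
    using that by (auto simp: cyclic_subgroups_def dest: subgroup.one_closed)
  have "inj_on (\<lambda>(A, B). A \<times> B) (cyclic_subgroups G \<times> cyclic_subgroups K)"
    using neG neK by (intro inj_onI) (auto simp: times_eq_iff)
  then have "cyc (G \<times>\<times> K) = cyc G * cyc K"
    by (simp add: cyc_def * card_image card_cartesian_product)
  moreover have "num_prime_divisors (G \<times>\<times> K) = num_prime_divisors G + num_prime_divisors K"
  proof -
    have "order (G \<times>\<times> K) = order G * order K" by (simp add: order_def card_cartesian_product)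
    then have "prime_factors (order (G \<times>\<times> K)) = prime_factors (order G) \<union> prime_factors (order K)"
      using G.order_pos K.order_pos by (simp add: prime_factors_product)
    moreover have "prime_factors (order G) \<inter> prime_factors (order K) = {}"
      using cop by (auto simp: in_prime_factors_iff dest: coprime_common_divisor)
    ultimately show ?thesis by (simp add: num_prime_divisors_def card_Un_disjoint)
  qed
  ultimately show ?thesis by (simp add: eta_def power_add)
qed

section \<open>The groups that attain the four values\<close>

text \<open>One subgroup for each of the orders 1, p and p^2, over a single prime; the one of order
  p consists of the multiples of p.\<close>

lemma eta_integer_mod_group_square:
  assumes p: "prime p"
  shows "eta (integer_mod_group (p ^ 2)) = 3/2"
proof -
  let ?G = "integer_mod_group (p ^ 2)"
  have p0: "p > 1" using prime_gt_1_nat[OF p] .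
  have car: "carrier ?G = {0..<int (p^2)}" using p0 by (simp add: carrier_integer_mod_group)
  interpret G: finite_group ?G using finite_groupI[of ?G] car by simp
  have ordG: "order ?G = p ^ 2" by (simp add: order_def car del: of_nat_power)
  have d: "G.ord x = 1 \<or> G.ord x = p \<or> G.ord x = p ^ 2" if "x \<in> carrier ?G" for x
  proof -
    have "G.ord x dvd p ^ 2" using G.ord_dvd_group_order[OF that] ordG by simp
    then obtain i where "i \<le> 2" "G.ord x = p ^ i" using divides_primepow_nat[OF p] by blast
    moreover have "i = 0 \<or> i = 1 \<or> i = 2" using calculation(1) by linarith
    ultimately show ?thesis by auto
  qed
  have gc: "card (generate ?G {x}) = G.ord x" if "x \<in> carrier ?G" for x using G.generate_pow_card[OF that] by simp
  let ?F = "(\<lambda>i. int p * i) ` {0..<int p}"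
  have cF: "card ?F = p" using p0 by (subst card_image) (auto intro!: inj_onI)
  have F: "generate ?G {x} = ?F" if x: "x \<in> carrier ?G" "G.ord x = p" for x
  proof (rule card_subset_eq)
    show "card (generate ?G {x}) = card ?F" using gc[OF x(1)] x(2) cF by simp
    show "generate ?G {x} \<subseteq> ?F"
    proof
      fix y assume y: "y \<in> generate ?G {x}"
      have yc: "y \<in> carrier ?G" using y subgroup.mem_carrier[OF G.generate_single_subgroup[OF x(1)]] by blast
      have "G.ord y dvd p" using G.ord_dvd_card[OF G.generate_single_subgroup[OF x(1)] y] gc[OF x(1)] x(2) by simp
      then have "(int p * y) mod int (p ^ 2) = 0" using G.pow_eq_id[OF yc, of p] by simp
      then have "int p * int p dvd int p * y" by (simp add: mod_eq_0_iff_dvd power2_eq_square)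
      then have "int p dvd y" using p0 by simp
      then obtain i where i: "y = int p * i" by (auto elim: dvdE)
      have "0 \<le> int p * i" "int p * i < int p * int p" using yc car i by (auto simp: power2_eq_square)
      then have "0 \<le> i" "i < int p" using p0 by (auto simp: zero_le_mult_iff)
      then show "y \<in> ?F" using i by auto
    qed
  qed simp
  have all: "generate ?G {x} = carrier ?G" if "x \<in> carrier ?G" "G.ord x = p ^ 2" for x
    using gc[OF that(1)] that ordG G.generate_single_subset[OF G.subgroup_self that(1)] G.finite_carrier
    by (intro card_subset_eq) (auto simp: order_def)
  have triv: "generate ?G {x} = {0}" if "x \<in> carrier ?G" "G.ord x = 1" for x
    using G.generate_one G.ord_eq_1[OF that(1)] that(2) by simp
  have pc: "int p \<in> carrier ?G" "1 \<in> carrier ?G" "0 \<in> carrier ?G"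
    using p0 car power_strict_increasing[of 1 2 "int p"] by auto
  have o1: "G.ord (int p) = p"
  proof -
    have "int p [^]\<^bsub>?G\<^esub> p = \<one>\<^bsub>?G\<^esub>" by (simp add: power2_eq_square)
    then have "G.ord (int p) dvd p" using G.pow_eq_id[OF pc(1)] by blast
    moreover have "G.ord (int p) \<noteq> 1" using G.ord_eq_1[OF pc(1)] p0 by simp
    ultimately show ?thesis using p by (auto simp: prime_nat_iff)
  qed
  have o2: "G.ord 1 = p ^ 2"
  proof -
    have "1 [^]\<^bsub>?G\<^esub> G.ord 1 = \<one>\<^bsub>?G\<^esub>" using G.pow_ord_eq_1[OF pc(2)] .
    then have "int (p ^ 2) dvd int (G.ord 1)" by (simp add: mod_eq_0_iff_dvd)
    then have "p ^ 2 dvd G.ord 1" by (simp only: int_dvd_int_iff)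
    then show ?thesis using G.ord_dvd_group_order[OF pc(2)] ordG by (simp add: dvd_antisym)
  qed
  have "cyclic_subgroups ?G = {{0}, ?F, carrier ?G}"
  proof (intro subset_antisym subsetI)
    fix H assume "H \<in> cyclic_subgroups ?G"
    then obtain x where "x \<in> carrier ?G" "H = generate ?G {x}" using G.cyclic_subgroups_eq by auto
    then show "H \<in> {{0}, ?F, carrier ?G}" using d[of x] F[of x] all[of x] triv[of x] by blast
  next
    fix H assume "H \<in> {{0}, ?F, carrier ?G}"
    then have "H = generate ?G {0} \<or> H = generate ?G {int p} \<or> H = generate ?G {1}"
      using F[OF pc(1) o1] all[OF pc(2) o2] G.generate_one by auto
    then show "H \<in> cyclic_subgroups ?G" using G.cyclic_subgroups_eq pc by auto
  qed
  moreover have "card {{0}, ?F, carrier ?G} = 3"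
  proof -
    have "card {0::int} = 1" "card (carrier ?G) = p ^ 2" using ordG by (auto simp: order_def)
    moreover have "p < p ^ 2" using p0 power_strict_increasing[of 1 2 p] by simp
    ultimately have "card {0::int} \<noteq> card ?F" "card {0::int} \<noteq> card (carrier ?G)" "card ?F \<noteq> card (carrier ?G)"
      using cF p0 by linarith+
    then have "{0} \<noteq> ?F" "{0} \<noteq> carrier ?G" "?F \<noteq> carrier ?G" by metis+
    then show ?thesis by simp
  qed
  ultimately have "cyc ?G = 3" by (simp add: cyc_def)
  moreover have "num_prime_divisors ?G = 1"
    using ordG p by (simp add: num_prime_divisors_def prime_factors_power prime_prime_factors)
  ultimately show ?thesis by (simp add: eta_def)
qed

text \<open>The dihedral group of order 2 n as affine maps modulo n: (False, a) is z \<mapsto> a + z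
  and (True, a) is z \<mapsto> a - z. Multiplication is composition.\<close>

definition dihedral :: "nat \<Rightarrow> (bool \<times> int) monoid" where
  "dihedral n = \<lparr>carrier = UNIV \<times> {0..<int n},
    monoid.mult = (\<lambda>(s, a) (t, b). (s \<noteq> t, (a + (if s then - b else b)) mod int n)), one = (False, 0)\<rparr>"

lemma dihedral_simps [simp]:
  "carrier (dihedral n) = UNIV \<times> {0..<int n}"
  "(s, a) \<otimes>\<^bsub>dihedral n\<^esub> (t, b) = (s \<noteq> t, (a + (if s then - b else b)) mod int n)"
  "\<one>\<^bsub>dihedral n\<^esub> = (False, 0)"
  by (simp_all add: dihedral_def)

lemma group_dihedral:
  assumes "n > 0" shows "group (dihedral n)"
proof (rule groupI)
  fix x y z assume x: "x \<in> carrier (dihedral n)" and y: "y \<in> carrier (dihedral n)" and z: "z \<in> carrier (dihedral n)"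
  obtain s a t b u c where e: "x = (s, a)" "y = (t, b)" "z = (u, c)" by (metis surj_pair)
  show "x \<otimes>\<^bsub>dihedral n\<^esub> y \<in> carrier (dihedral n)" using assms e by simp
  show "x \<otimes>\<^bsub>dihedral n\<^esub> y \<otimes>\<^bsub>dihedral n\<^esub> z = x \<otimes>\<^bsub>dihedral n\<^esub> (y \<otimes>\<^bsub>dihedral n\<^esub> z)"
    unfolding e by (auto simp: mod_simps algebra_simps)
  show "\<one>\<^bsub>dihedral n\<^esub> \<otimes>\<^bsub>dihedral n\<^esub> x = x" using x e by simp
  show "\<exists>y\<in>carrier (dihedral n). y \<otimes>\<^bsub>dihedral n\<^esub> x = \<one>\<^bsub>dihedral n\<^esub>"
  proof (cases s)
    case True
    then have "x \<otimes>\<^bsub>dihedral n\<^esub> x = \<one>\<^bsub>dihedral n\<^esub>" using e by simp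
    then show ?thesis using x by blast
  next
    case False
    have "(False, (- a) mod int n) \<otimes>\<^bsub>dihedral n\<^esub> x = \<one>\<^bsub>dihedral n\<^esub>" using False e by (simp add: mod_simps)
    moreover have "(False, (- a) mod int n) \<in> carrier (dihedral n)" using assms by simp
    ultimately show ?thesis by blast
  qed
qed (use assms in simp)

text \<open>Each of the p reflections generates its own subgroup of order 2, every nontrivial
  rotation generates the rotation group, and the trivial group is added: p + 2 subgroups over two
  primes.\<close>

lemma eta_dihedral:
  assumes p: "prime p" "odd p"
  shows "eta (dihedral p) = (real p + 2) / 4"
proof -
  let ?G = "dihedral p"
  have p0: "p > 1" using prime_gt_1_nat[OF p(1)] .
  interpret G: finite_group ?G using finite_groupI[OF group_dihedral] p0 by simp
  have ordG: "order ?G = 2 * p" by (simp add: order_def card_cartesian_product)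
  let ?R = "{False} \<times> {0..<int p}"
  have R: "subgroup ?R ?G"
  proof (rule G.subgroupI)
    fix x assume x: "x \<in> ?R"
    then obtain a where a: "x = (False, a)" by auto
    have "(False, (- a) mod int p) \<otimes>\<^bsub>?G\<^esub> x = \<one>\<^bsub>?G\<^esub>" using a by (simp add: mod_simps)
    then have "inv\<^bsub>?G\<^esub> x = (False, (- a) mod int p)" using x p0 by (intro G.inv_equality) auto
    then show "inv\<^bsub>?G\<^esub> x \<in> ?R" using p0 by simp
  qed (use p0 in auto)
  have cR: "card ?R = p" by (simp add: card_cartesian_product)
  have genR: "generate ?G {(False, a)} = ?R" if "a \<in> {0..<int p}" "a \<noteq> 0" for a
    using G.order_p_generate(1)[OF p(1) R cR, of "(False, a)"] that by simp
  have genT: "generate ?G {(True, a)} = {(False, 0), (True, a)}" if a: "a \<in> {0..<int p}" for a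
  proof -
    have c: "(True, a) \<in> carrier ?G" using a by simp
    have "(True, a) [^]\<^bsub>?G\<^esub> (2::nat) = \<one>\<^bsub>?G\<^esub>" using a by (simp add: numeral_2_eq_2)
    then have "G.ord (True, a) dvd 2" using G.pow_eq_id[OF c] by blast
    moreover have "G.ord (True, a) \<noteq> 1" using G.ord_eq_1[OF c] by simp
    ultimately have "G.ord (True, a) = 2" using two_is_prime_nat unfolding prime_nat_iff by blast
    then show ?thesis using G.generate_involution[OF c] by simp
  qed
  have gen1: "generate ?G {(False, 0)} = {(False, 0)}" using G.generate_one by simp
  let ?T = "(\<lambda>a. {(False, 0), (True, a)}) ` {0..<int p}"
  have "cyclic_subgroups ?G = {{(False, 0)}, ?R} \<union> ?T"
  proof (intro subset_antisym subsetI)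
    fix H assume "H \<in> cyclic_subgroups ?G"
    then obtain s a where "a \<in> {0..<int p}" "H = generate ?G {(s, a)}" using G.cyclic_subgroups_eq by auto
    then show "H \<in> {{(False, 0)}, ?R} \<union> ?T"
      using genR[of a] genT[of a] gen1 by (cases s; cases "a = 0") auto
  next
    fix H assume "H \<in> {{(False, 0)}, ?R} \<union> ?T"
    then consider "H = {(False, 0)}" | "H = ?R" | a where "a \<in> {0..<int p}" "H = {(False, 0), (True, a)}" by blast
    then have "\<exists>x\<in>carrier ?G. H = generate ?G {x}"
    proof cases
      case 1 then show ?thesis using gen1 p0 by (intro bexI[of _ "(False, 0)"]) auto
    next
      case 2 then show ?thesis using genR[of 1] p0 by (intro bexI[of _ "(False, 1)"]) auto
    next
      case (3 a) then show ?thesis using genT[of a] by (intro bexI[of _ "(True, a)"]) auto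
    qed
    then show "H \<in> cyclic_subgroups ?G" unfolding G.cyclic_subgroups_eq by blast
  qed
  moreover have "card ({{(False, 0)}, ?R} \<union> ?T) = 2 + p"
  proof -
    have "{(False, 0)} \<noteq> ?R" using cR p0 by (metis card.empty card.insert One_nat_def empty_iff finite.emptyI less_irrefl)
    moreover have "card ?T = p" by (subst card_image) (auto intro!: inj_onI simp: doubleton_eq_iff)
    moreover have "{{(False, 0)}, ?R} \<inter> ?T = {}" by auto
    ultimately show ?thesis by (subst card_Un_disjoint) auto
  qed
  ultimately have "cyc ?G = 2 + p" by (simp add: cyc_def)
  moreover have "num_prime_divisors ?G = 2"
  proof -
    have "prime_factors (2 * p) = {2, p}"
      using p p0 by (simp add: prime_factors_product prime_prime_factors insert_commute)
    then show ?thesis using p ordG by (auto simp: num_prime_divisors_def card_insert_if)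
  qed
  ultimately show ?thesis by (simp add: eta_def)
qed

lemma eta_examples:
  assumes "v \<in> {5/4, 3/2, 7/4, 15/8}"
  shows "\<exists>H :: nat monoid. group H \<and> finite (carrier H) \<and> eta H = v"
proof -
  have p: "prime (3::nat)" "prime (5::nat)" by simp_all
  have D: "group (dihedral n) \<and> finite (carrier (dihedral n))" if "n > 0" for n
    using group_dihedral[OF that] by simp
  \<comment> \<open>The cyclic example has order 25 so that it is coprime to the order 6 of
    \<open>?D\<close>; their product then attains 5/4 * 3/2 = 15/8.\<close>
  let ?C = "integer_mod_group (5 ^ 2)" and ?D = "dihedral 3"
  have C: "group ?C" "finite (carrier ?C)" by (simp_all add: carrier_integer_mod_group)
  have e: "eta ?D = 5/4" "eta (dihedral 5) = 7/4" "eta ?C = 3/2"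
    using eta_dihedral[OF p(1)] eta_dihedral[OF p(2)] eta_integer_mod_group_square[OF p(2)] by simp_all
  have "coprime (order ?D) (order ?C)"
    by (simp add: order_def card_cartesian_product carrier_integer_mod_group coprime_iff_gcd_eq_1 gcd_non_0_nat)
  then have "eta (?D \<times>\<times> ?C) = 15/8" using eta_DirProd[of ?D ?C] D[of 3] C e by simp
  moreover have "group (?D \<times>\<times> ?C)" "finite (carrier (?D \<times>\<times> ?C))"
    using DirProd_group[of ?D ?C] D[of 3] C by auto
  ultimately show ?thesis
    using assms exists_nat_group[of ?D] exists_nat_group[of "dihedral 5"] exists_nat_group[of ?C]
      exists_nat_group[of "?D \<times>\<times> ?C"] D[of 3] D[of 5] C e by auto
qed

theorem theorem4p4:
  fixes G :: "('a, 'b) monoid_scheme"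
  shows "(group G \<and> finite (carrier G) \<and> 1 < eta G \<and> eta G < 2
            \<longrightarrow> eta G \<in> {5/4, 3/2, 7/4, 15/8})
       \<and> (\<forall>v \<in> {5/4, 3/2, 7/4, 15/8}.
            \<exists>H :: nat monoid. group H \<and> finite (carrier H) \<and> eta H = v)"
proof (intro conjI impI ballI)
  assume G: "group G \<and> finite (carrier G) \<and> 1 < eta G \<and> eta G < 2"
  then interpret finite_group G by (intro finite_groupI) auto
  show "eta G \<in> {5/4, 3/2, 7/4, 15/8}" using eta_values G by auto
qed (rule eta_examples)

end
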